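(* Let $U,V$ be complex vector spaces of dimensions $m$ and $n$, and let $1\le n'\le n$. The defining ideal of the subspace variety $\mathrm{Sub}_{m,n'}\subseteq U^*\otimes S^2V^*$ equals $I_{\kappa_0\le n'}$.
   Context: The subspace variety $\mathrm{Sub}_{m',n'}$ is the variety of tensors $x\in U^*\otimes S^2V^*$ such that there exist vector subspaces $\widetilde U^*\subset U^*$ and $\widetilde V^*\subset V^*$ of dimensions $m'$ and $n'$ respectively with $x\in\widetilde U^*\otimes S^2\widetilde V^*\subset U^*\otimes S^2V^*$; here $m'=m=\dim U$. Write $x\in U^*\otimes S^2V^*$ as $x=\sum_{i=1}^me_i\otimes A_i$ with $e_1,\dots,e_m$ a basis of $U^*$ and $A_i$ symmetric $n\times n$ matrices. The flattening $\psi_{0,x}\colon V\to V^*\otimes U^*$ is represented by the $mn\times n$ matrix of linear forms obtained by stacking $A_1,\dots,A_m$. $I_{\kappa_0\le n'}$ is the ideal of the polynomial ring $S^\bullet(U\otimes S^2V)$ on $U^*\otimes S^2V^*$ generated by the $(n'+1)\times(n'+1)$ minors of $\psi_{0,x}$. *)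

theory Defs
  imports
    "HOL-Analysis.Analysis"
    "HOL-Library.Poly_Mapping"
    "HOL-Library.Uprod"
    "Jordan_Normal_Form.Determinant"
begin

no_notation Matrix.vec_index (infixl \<open>$\<close> 100)

instance uprod :: (finite) finite
  by standard simp

text \<open>
  With respect to bases of the dual spaces, \<open>U\<^sup>*\<close> is \<open>complex^'m\<close> and \<open>V\<^sup>*\<close> is \<open>complex^'n\<close>.
  The monomials \<open>f\<^sub>j f\<^sub>k\<close> in the basis of \<open>V\<^sup>*\<close>, a basis of \<open>S\<^sup>2V\<^sup>*\<close>, are indexed by unordered
  pairs, so \<open>U\<^sup>* \<otimes> S\<^sup>2V\<^sup>*\<close> is the whole space \<open>complex^('m \<times> 'n uprod)\<close>.  The coordinate of \<open>x\<close> at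
  \<open>(i, Upair j k)\<close> is by convention the \<open>(j, k)\<close> entry of the symmetric matrix \<open>A\<^sub>i\<close>
  in \<open>x = \<Sum>\<^sub>i e\<^sub>i \<otimes> A\<^sub>i\<close>.
\<close>

type_synonym ('m, 'n) sym_tensor = "complex ^ ('m \<times> 'n uprod)"

text \<open>The product \<open>v w\<close> in \<open>S\<^sup>2V\<^sup>*\<close>, as the symmetric matrix \<open>(v w\<^sup>T + w v\<^sup>T) / 2\<close>.\<close>

lift_definition sym_prod :: "complex ^ 'n \<Rightarrow> complex ^ 'n \<Rightarrow> 'n uprod \<Rightarrow> complex"
  is "\<lambda>v w (j, k). (v $ j * w $ k + v $ k * w $ j) / 2"
  by (auto simp: eq_upair_def)

lemma sym_prod_Upair [simp]:
  "sym_prod v w (Upair j k) = (v $ j * w $ k + v $ k * w $ j) / 2"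
  by transfer simp

definition pure_tensor ::
    "complex ^ 'm \<Rightarrow> complex ^ 'n \<Rightarrow> complex ^ 'n \<Rightarrow> ('m::finite, 'n::finite) sym_tensor" where
  "pure_tensor u v w = (\<chi> a. u $ fst a * sym_prod v w (snd a))"

definition tensor_sym2 ::
    "(complex ^ 'm) set \<Rightarrow> (complex ^ 'n) set \<Rightarrow> ('m::finite, 'n::finite) sym_tensor set" where
  "tensor_sym2 A B = vec.span {pure_tensor u v w | u v w. u \<in> A \<and> v \<in> B \<and> w \<in> B}"

text \<open>
  The notions \<open>vec.subspace\<close>, \<open>vec.dim\<close>, \<open>vec.span\<close> are those over the scalar field \<open>complex\<close>
  (unlike \<open>subspace\<close>, \<open>dim\<close>, \<open>span\<close>, which are over the reals).
\<close>

definition subspace_variety :: "nat \<Rightarrow> nat \<Rightarrow> ('m::finite, 'n::finite) sym_tensor set" where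
  "subspace_variety m' n' =
    {x. \<exists>A B. vec.subspace A \<and> vec.dim A = m' \<and> vec.subspace B \<and> vec.dim B = n' \<and>
              x \<in> tensor_sym2 A B}"

text \<open>Polynomials with one variable for each \<open>v :: 'v\<close>; monomials are exponent vectors.\<close>

type_synonym 'v mpolynomial = "('v \<Rightarrow>\<^sub>0 nat) \<Rightarrow>\<^sub>0 complex"

definition Var :: "'v \<Rightarrow> 'v mpolynomial" where
  "Var v = Poly_Mapping.single (Poly_Mapping.single v 1) 1"

definition poly_eval :: "complex ^ 'v \<Rightarrow> ('v::finite) mpolynomial \<Rightarrow> complex" where
  "poly_eval x p =
    (\<Sum>e\<in>Poly_Mapping.keys p. Poly_Mapping.lookup p e * (\<Prod>v\<in>UNIV. (x $ v) ^ Poly_Mapping.lookup e v))"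

lemma poly_eval_Var [simp]: "poly_eval x (Var v) = x $ v"
proof -
  have "(\<Prod>w\<in>UNIV. (x $ w) ^ Poly_Mapping.lookup (Poly_Mapping.single v 1) w) =
        (\<Prod>w\<in>UNIV. if w = v then x $ w else 1)"
    by (rule prod.cong) (auto simp: lookup_single when_def)
  then show ?thesis
    by (simp add: poly_eval_def Var_def)
qed

definition vanishing_ideal :: "(complex ^ 'v) set \<Rightarrow> ('v::finite) mpolynomial set" where
  "vanishing_ideal X = {p. \<forall>x\<in>X. poly_eval x p = 0}"

text \<open>An ideal is a submodule of the ring regarded as a module over itself.\<close>

definition ideal_generated :: "'r::comm_ring_1 set \<Rightarrow> 'r set" where
  "ideal_generated S = Modules.module.span (*) S"

lemma ideal_generated_eq:
  "ideal_generated S = {\<Sum>a\<in>T. r a * a | T r. finite T \<and> T \<subseteq> S}"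
  for S :: "'r::comm_ring_1 set"
proof -
  have "Modules.module ((*) :: 'r \<Rightarrow> 'r \<Rightarrow> 'r)"
    by standard (auto simp: algebra_simps)
  then show ?thesis
    unfolding ideal_generated_def by (rule Modules.module.span_explicit)
qed

text \<open>
  The matrix \<open>A\<^sub>i\<close>, and the matrix with rows indexed by \<open>(i, j)\<close> obtained by stacking all \<open>A\<^sub>i\<close>.
  The coordinates \<open>z\<close> may be those of a tensor or the variables of the polynomial ring.
\<close>

definition slice :: "('m \<times> 'n::finite uprod \<Rightarrow> 'a) \<Rightarrow> 'm \<Rightarrow> 'a ^ 'n ^ 'n" where
  "slice z i = (\<chi> j k. z (i, Upair j k))"

definition flattening :: "('m::finite \<times> 'n::finite uprod \<Rightarrow> 'a) \<Rightarrow> 'a ^ 'n ^ ('m \<times> 'n)" where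
  "flattening z = (\<chi> r. slice z (fst r) $ snd r)"

text \<open>
  All orderings of the chosen rows and columns are allowed; this adds only the negatives of minors.
  For \<open>k\<close> larger than the number of rows or columns there are no minors.
\<close>

definition minors :: "nat \<Rightarrow> ('a::comm_ring_1) ^ 'c ^ 'r \<Rightarrow> 'a set" where
  "minors k M =
    {Determinant.det (Matrix.mat k k (\<lambda>(a, b). M $ \<rho> a $ \<gamma> b)) | \<rho> \<gamma>.
       inj_on \<rho> {..<k} \<and> inj_on \<gamma> {..<k}}"

text \<open>The ideal \<open>I\<^bsub>\<kappa>\<^sub>0 \<le> n'\<^esub>\<close>.\<close>

definition I_kappa0_le :: "nat \<Rightarrow> ('m::finite \<times> 'n::finite uprod) mpolynomial set" where
  "I_kappa0_le n' = ideal_generated (minors (n' + 1) (flattening Var))"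

end

theory Submission
  imports Defs
begin

text \<open>
  Each homogeneous component of degree \<open>d\<close> of a polynomial vanishing on the subspace variety, which
  is a cone, is polarised to a form that is multilinear in \<open>2d\<close> vectors of \<open>V\<^sup>*\<close>,
  two for each factor, and vanishes whenever these span at most \<open>r = n'\<close> dimensions.
  The multilinear second fundamental theorem says that such a form is a
  combination of forms antisymmetrised over \<open>r + 1\<close> of the \<open>2d\<close> slots.  Turned back into
  polynomials on \<open>U\<^sup>* \<otimes> S\<^sup>2V\<^sup>*\<close>, these are zero or multiples of minors of the flattening.

  The second fundamental theorem has a triangularity proof.  View the form as a combination of words
  and take the lexicographically largest one.  If it has a strictly decreasing subsequence of length
  \<open>r + 1\<close>, subtracting a multiple of an antisymmetriser replaces it by smaller words.  Otherwise its
  positions split into \<open>r\<close> weakly increasing subsequences; the word is then the smallest one among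
  those with the same letters in each class, and evaluating the form with one of \<open>r\<close> generic vectors
  for each class isolates its coefficient, which must vanish.
\<close>

section \<open>Independence of monomials and alternating sums\<close>

text \<open>Doubling one variable \<open>v\<close> multiplies each monomial by its own power of 2.
  Subtracting a multiple of the original relation cancels a chosen \<open>N\<close> and keeps a
  nonzero multiple of the coefficient of \<open>M\<close>, as \<open>v\<close> has different
  multiplicities in \<open>M\<close> and \<open>N\<close>.\<close>

lemma monomial_functions_independent:
  fixes c :: "'v multiset \<Rightarrow> complex"
  assumes "finite S" "\<And>x. (\<Sum>M\<in>S. c M * (\<Prod>v\<in>#M. x v)) = 0" "M \<in> S"
  shows "c M = 0"
  using assms
proof (induction arbitrary: c M rule: finite_psubset_induct)
  case (psubset S)
  show ?case
  proof (cases "S = {M}")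
    case True
    then show ?thesis
      using psubset.prems(1)[of "\<lambda>_. 1"] by simp
  next
    case False
    with \<open>M \<in> S\<close> obtain N where N: "N \<in> S" "N \<noteq> M"
      by blast
    then obtain v where v: "count N v \<noteq> count M v"
      by (auto simp: multiset_eq_iff)
    define \<kappa> where "\<kappa> L = (2 :: complex) ^ count L v" for L :: "'v multiset"
    have \<kappa>: "(\<Prod>u\<in>#L. x u * (if u = v then 2 else 1)) = (\<Prod>u\<in>#L. x u) * \<kappa> L"
      for L and x :: "'v \<Rightarrow> complex"
      by (induction L) (auto simp: \<kappa>_def)
    have "(\<Sum>L\<in>S - {N}. (c L * (\<kappa> L - \<kappa> N)) * (\<Prod>u\<in>#L. x u)) = 0" for x
    proof -
      have "(\<Sum>L\<in>S - {N}. (c L * (\<kappa> L - \<kappa> N)) * (\<Prod>u\<in>#L. x u)) =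
            (\<Sum>L\<in>S. (c L * (\<kappa> L - \<kappa> N)) * (\<Prod>u\<in>#L. x u))"
        using N \<open>finite S\<close> by (subst sum.remove[of S N]) auto
      also have "\<dots> = (\<Sum>L\<in>S. c L * (\<Prod>u\<in>#L. x u * (if u = v then 2 else 1)))
                    - \<kappa> N * (\<Sum>L\<in>S. c L * (\<Prod>u\<in>#L. x u))"
        by (simp only: \<kappa>) (simp add: algebra_simps sum_subtractf sum_distrib_left)
      finally show ?thesis
        by (simp only: psubset.prems(1)) simp
    qed
    moreover have "S - {N} \<subset> S" "M \<in> S - {N}"
      using N \<open>M \<in> S\<close> by auto
    ultimately have "c M * (\<kappa> M - \<kappa> N) = 0"
      using psubset.IH[of "S - {N}" "\<lambda>L. c L * (\<kappa> L - \<kappa> N)" M] by blast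
    moreover have "\<kappa> M \<noteq> \<kappa> N"
    proof
      assume "\<kappa> M = \<kappa> N"
      then have "(of_nat (2 ^ count M v) :: complex) = of_nat (2 ^ count N v)"
        by (simp add: \<kappa>_def)
      then have "(2 :: nat) ^ count M v = 2 ^ count N v"
        by (simp only: of_nat_eq_iff)
      with v show False by simp
    qed
    ultimately show ?thesis by simp
  qed
qed

text \<open>Several terms may share a monomial, as happens when a product of sums is
  expanded.\<close>

lemma monomial_coefficient_zero:
  fixes c :: "'q \<Rightarrow> complex" and m :: "'q \<Rightarrow> 'v multiset"
  assumes "finite Q" and "\<And>x. (\<Sum>q\<in>Q. c q * (\<Prod>v\<in>#m q. x v)) = 0"
  shows "(\<Sum>q | q \<in> Q \<and> m q = M. c q) = 0"
proof (cases "M \<in> m ` Q")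
  case True
  have "(\<Sum>N\<in>m ` Q. (\<Sum>q | q \<in> Q \<and> m q = N. c q) * (\<Prod>v\<in>#N. x v)) = 0" for x
  proof -
    have "(\<Sum>N\<in>m ` Q. (\<Sum>q | q \<in> Q \<and> m q = N. c q) * (\<Prod>v\<in>#N. x v)) =
          (\<Sum>q\<in>Q. c q * (\<Prod>v\<in>#m q. x v))"
      by (subst sum.image_gen[OF \<open>finite Q\<close>, of _ m]) (simp add: sum_distrib_right)
    with assms(2) show ?thesis by simp
  qed
  from monomial_functions_independent[OF _ this True] \<open>finite Q\<close> show ?thesis
    by simp
next
  case False
  then have no_terms: "{q. q \<in> Q \<and> m q = M} = {}"
    by blast
  show ?thesis
    unfolding no_terms by simp
qed

text \<open>Composition with the transposition exchanges even and odd permutations without changing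
  \<psi>. Splitting by parity, rather than showing that the sum equals its negative, keeps this
  valid in rings where 2 is a zero divisor.\<close>

lemma sum_sign_eq_0:
  fixes \<psi> :: "('p \<Rightarrow> 'p) \<Rightarrow> 'r :: ring_1"
  assumes "x \<in> S" "y \<in> S" "x \<noteq> y" "finite S"
    and inv: "\<And>\<sigma>. \<sigma> permutes S \<Longrightarrow> \<psi> (\<sigma> \<circ> Transposition.transpose x y) = \<psi> \<sigma>"
  shows "(\<Sum>\<sigma> | \<sigma> permutes S. of_int (sign \<sigma>) * \<psi> \<sigma>) = 0"
proof -
  let ?E = "{\<sigma>. \<sigma> permutes S \<and> evenperm \<sigma>}" and ?O = "{\<sigma>. \<sigma> permutes S \<and> \<not> evenperm \<sigma>}"
  have tr: "Transposition.transpose x y permutes S"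
    using assms by (simp add: permutes_swap_id)
  have odd: "evenperm (\<sigma> \<circ> Transposition.transpose x y) \<longleftrightarrow> \<not> evenperm \<sigma>" if "\<sigma> permutes S" for \<sigma>
  proof -
    have "permutation \<sigma>" "permutation (Transposition.transpose x y)"
      using that tr \<open>finite S\<close> by (auto simp: permutation_permutes)
    then show ?thesis
      using \<open>x \<noteq> y\<close> by (simp add: evenperm_comp evenperm_swap)
  qed
  have swap: "(\<Sum>\<sigma>\<in>?O. \<psi> \<sigma>) = (\<Sum>\<sigma>\<in>?E. \<psi> \<sigma>)"
    by (rule sum.reindex_bij_witness[of _ "\<lambda>\<sigma>. \<sigma> \<circ> Transposition.transpose x y" "\<lambda>\<sigma>. \<sigma> \<circ> Transposition.transpose x y"])
      (use tr in \<open>auto simp: odd inv comp_assoc permutes_compose\<close>)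
  have fin: "finite ?E" "finite ?O"
    using finite_permutations[OF \<open>finite S\<close>] by simp_all
  have "{\<sigma>. \<sigma> permutes S} = ?E \<union> ?O"
    by blast
  then have "(\<Sum>\<sigma> | \<sigma> permutes S. of_int (sign \<sigma>) * \<psi> \<sigma>) =
      (\<Sum>\<sigma>\<in>?E. of_int (sign \<sigma>) * \<psi> \<sigma>) + (\<Sum>\<sigma>\<in>?O. of_int (sign \<sigma>) * \<psi> \<sigma>)"
    by (simp only:, intro sum.union_disjoint fin) blast
  also have "(\<Sum>\<sigma>\<in>?E. of_int (sign \<sigma>) * \<psi> \<sigma>) = (\<Sum>\<sigma>\<in>?E. \<psi> \<sigma>)"
    by (rule sum.cong) (simp_all add: sign_def)
  also have "(\<Sum>\<sigma>\<in>?O. of_int (sign \<sigma>) * \<psi> \<sigma>) = - (\<Sum>\<sigma>\<in>?E. \<psi> \<sigma>)"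
    unfolding swap[symmetric] sum_negf[symmetric] by (rule sum.cong) (simp_all add: sign_def)
  finally show ?thesis by simp
qed

section \<open>Words in lexicographic order\<close>

locale ordered_words =
  fixes P :: "'p set" and ord :: "'p \<Rightarrow> nat" and idx :: "'a :: finite \<Rightarrow> nat"
  assumes finite_P: "finite P" and inj_ord: "inj_on ord P" and inj_idx: "inj idx"
begin

definition words :: "('p \<Rightarrow> 'a) set" where
  "words = P \<rightarrow>\<^sub>E UNIV"

definition lex_less :: "('p \<Rightarrow> 'a) \<Rightarrow> ('p \<Rightarrow> 'a) \<Rightarrow> bool" where
  "lex_less u w \<longleftrightarrow> (\<exists>t\<in>P. idx (u t) < idx (w t) \<and> (\<forall>s\<in>P. ord s < ord t \<longrightarrow> u s = w s))"

text \<open>Counting smaller words turns the lexicographic order into a natural number for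
  induction.\<close>

definition lex_rank :: "('p \<Rightarrow> 'a) \<Rightarrow> nat" where
  "lex_rank w = card {u \<in> words. lex_less u w}"

definition decreasing_on :: "'p set \<Rightarrow> ('p \<Rightarrow> 'a) \<Rightarrow> bool" where
  "decreasing_on S w \<longleftrightarrow> (\<forall>s\<in>S. \<forall>t\<in>S. ord s < ord t \<longrightarrow> idx (w t) < idx (w s))"

lemma finite_words: "finite words"
  using finite_P by (simp add: words_def finite_PiE)

lemma comp_permutes_in_words:
  assumes "w \<in> words" "S \<subseteq> P" "\<sigma> permutes S"
  shows "w \<circ> \<sigma> \<in> words"
proof -
  have "\<sigma> x = x" if "x \<notin> P" for x
    using that assms by (auto simp: permutes_def)
  with assms(1) show ?thesis
    by (auto simp: words_def PiE_def extensional_def)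
qed

lemma first_element:
  assumes "A \<subseteq> P" "A \<noteq> {}"
  obtains t where "t \<in> A" "\<And>s. s \<in> P \<Longrightarrow> ord s < ord t \<Longrightarrow> s \<notin> A"
proof -
  from assms obtain x where "x \<in> A" by blast
  then obtain t where "t \<in> A" "\<forall>y. y \<in> A \<longrightarrow> ord t \<le> ord y"
    using ex_has_least_nat[of "\<lambda>y. y \<in> A" x ord] by blast
  then show thesis
    using that by (meson not_le)
qed

lemma first_difference:
  assumes "u \<in> words" "w \<in> words" "u \<noteq> w"
  obtains t where "t \<in> P" "u t \<noteq> w t" "\<And>s. s \<in> P \<Longrightarrow> ord s < ord t \<Longrightarrow> u s = w s"
proof -
  have "{t \<in> P. u t \<noteq> w t} \<noteq> {}"
    using assms unfolding words_def by (metis (mono_tags, lifting) PiE_ext empty_iff mem_Collect_eq)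
  then obtain t where "t \<in> {t \<in> P. u t \<noteq> w t}"
      "\<And>s. s \<in> P \<Longrightarrow> ord s < ord t \<Longrightarrow> s \<notin> {t \<in> P. u t \<noteq> w t}"
    using first_element[of "{t \<in> P. u t \<noteq> w t}"] by blast
  then show thesis
    using that[of t] by blast
qed

lemma lex_less_irrefl: "\<not> lex_less w w"
  by (simp add: lex_less_def)

lemma lex_less_trans:
  assumes "lex_less u v" "lex_less v w"
  shows "lex_less u w"
proof -
  obtain s where s: "s \<in> P" "idx (u s) < idx (v s)" "\<forall>x\<in>P. ord x < ord s \<longrightarrow> u x = v x"
    using assms(1) by (auto simp: lex_less_def)
  obtain t where t: "t \<in> P" "idx (v t) < idx (w t)" "\<forall>x\<in>P. ord x < ord t \<longrightarrow> v x = w x"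
    using assms(2) by (auto simp: lex_less_def)
  consider "ord s < ord t" | "ord t < ord s" | "s = t"
    using s(1) t(1) inj_ord by (meson inj_onD linorder_neqE_nat)
  then show ?thesis
  proof cases
    case 1
    with s t show ?thesis
      unfolding lex_less_def by (intro bexI[of _ s]) auto
  next
    case 2
    with s t show ?thesis
      unfolding lex_less_def by (intro bexI[of _ t]) auto
  next
    case 3
    with s t show ?thesis
      unfolding lex_less_def by (intro bexI[of _ t]) auto
  qed
qed

lemma lex_less_total:
  assumes "u \<in> words" "w \<in> words" "u \<noteq> w"
  shows "lex_less u w \<or> lex_less w u"
proof -
  obtain t where t: "t \<in> P" "u t \<noteq> w t" "\<And>s. s \<in> P \<Longrightarrow> ord s < ord t \<Longrightarrow> u s = w s"
    using first_difference[OF assms] by metis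
  then have "idx (u t) \<noteq> idx (w t)"
    using inj_idx by (simp add: inj_eq)
  with t show ?thesis
    unfolding lex_less_def by (metis linorder_neqE_nat)
qed

lemma lex_rank_less:
  assumes "lex_less u w" "u \<in> words"
  shows "lex_rank u < lex_rank w"
  unfolding lex_rank_def
proof (rule psubset_card_mono)
  show "finite {v \<in> words. lex_less v w}"
    using finite_words by simp
  show "{v \<in> words. lex_less v u} \<subset> {v \<in> words. lex_less v w}"
    using assms lex_less_trans lex_less_irrefl by blast
qed

lemma lex_rank_eq_imp_eq:
  assumes "lex_rank u = lex_rank w" "u \<in> words" "w \<in> words"
  shows "u = w"
  using assms lex_less_total lex_rank_less by (metis less_irrefl)

text \<open>The first position moved by \<sigma> receives a letter from a later one, because all
  earlier positions are fixed; on \<open>S\<close> later letters are smaller.\<close>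

lemma lex_less_comp_permutes:
  assumes "S \<subseteq> P" "decreasing_on S w" "\<sigma> permutes S" "\<sigma> \<noteq> id"
  shows "lex_less (w \<circ> \<sigma>) w"
proof -
  have "{t \<in> S. \<sigma> t \<noteq> t} \<noteq> {}"
    using assms(3,4) by (auto simp: permutes_def fun_eq_iff)
  then obtain t where t: "t \<in> S" "\<sigma> t \<noteq> t"
      "\<And>s. s \<in> P \<Longrightarrow> ord s < ord t \<Longrightarrow> s \<notin> {t \<in> S. \<sigma> t \<noteq> t}"
    using first_element[of "{t \<in> S. \<sigma> t \<noteq> t}"] assms(1) by blast
  have \<sigma>t: "\<sigma> t \<in> S"
    using t(1) assms(3) by (simp add: permutes_in_image)
  have fixed: "\<sigma> s = s" if "s \<in> P" "ord s < ord t" for s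
    using t(3)[OF that] assms(3) by (auto simp: permutes_def)
  have "ord t < ord (\<sigma> t)"
  proof (rule ccontr)
    assume "\<not> ord t < ord (\<sigma> t)"
    moreover have "ord (\<sigma> t) \<noteq> ord t"
      using inj_ord t(1,2) \<sigma>t assms(1) by (meson inj_onD subsetD)
    ultimately have "\<sigma> (\<sigma> t) = \<sigma> t"
      using fixed[of "\<sigma> t"] \<sigma>t assms(1) by auto
    with t(2) assms(3) show False
      by (metis permutes_inj injD)
  qed
  then have "idx (w (\<sigma> t)) < idx (w t)"
    using assms(2) t(1) \<sigma>t by (auto simp: decreasing_on_def)
  then show ?thesis
    using t(1) assms(1) fixed unfolding lex_less_def by (intro bexI[of _ t]) auto
qed

text \<open>If every class \<open>q\<close> has its own vector with coordinates
  \<open>x (q, y)\<close>, this is the monomial in these coordinates to which the word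
  evaluates.\<close>

definition content :: "('p \<Rightarrow> 'c) \<Rightarrow> ('p \<Rightarrow> 'a) \<Rightarrow> ('c \<times> 'a) multiset" where
  "content a w = image_mset (\<lambda>p. (a p, w p)) (mset_set P)"

lemma count_content: "count (content a w) (q, x) = card {p \<in> P. a p = q \<and> w p = x}"
proof -
  have "count (content a w) (q, x) = (\<Sum>p\<in>{p \<in> P. a p = q \<and> w p = x}. 1)"
    unfolding content_def count_image_mset using finite_P by (intro sum.cong) auto
  then show ?thesis by simp
qed

text \<open>Let \<open>t\<close> be the first difference. If \<open>u t\<close> were below
  \<open>w t\<close>, then in \<open>w\<close> the letter \<open>u t\<close> could occur in the
  class of \<open>t\<close> only before \<open>t\<close>, where both words agree; \<open>u\<close>
  would contain it at least once more, against equal contents.\<close>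

lemma lex_less_of_content_eq:
  assumes incr: "\<And>s t. s \<in> P \<Longrightarrow> t \<in> P \<Longrightarrow> a s = a t \<Longrightarrow> ord s < ord t \<Longrightarrow> idx (w s) \<le> idx (w t)"
    and "u \<in> words" "w \<in> words" "u \<noteq> w" "content a u = content a w"
  shows "lex_less w u"
proof -
  obtain t where t: "t \<in> P" "u t \<noteq> w t" "\<And>s. s \<in> P \<Longrightarrow> ord s < ord t \<Longrightarrow> u s = w s"
    using first_difference assms by metis
  have "\<not> idx (u t) < idx (w t)"
  proof
    assume less: "idx (u t) < idx (w t)"
    have "{p \<in> P. a p = a t \<and> w p = u t} \<subset> {p \<in> P. a p = a t \<and> u p = u t}"
    proof (rule psubsetI)
      show "{p \<in> P. a p = a t \<and> w p = u t} \<subseteq> {p \<in> P. a p = a t \<and> u p = u t}"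
      proof clarify
        fix p assume p: "p \<in> P" "a p = a t" "w p = u t"
        have "\<not> ord t < ord p"
          using incr[of t p] p t(1) less by auto
        moreover have "ord p \<noteq> ord t"
          using p t(1,2) inj_ord by (metis inj_onD)
        ultimately show "u p = u t"
          using t(3)[of p] p by simp
      qed
      show "{p \<in> P. a p = a t \<and> w p = u t} \<noteq> {p \<in> P. a p = a t \<and> u p = u t}"
        using t(1,2) by (metis (mono_tags, lifting) mem_Collect_eq)
    qed
    then have "count (content a w) (a t, u t) < count (content a u) (a t, u t)"
      unfolding count_content using finite_P by (intro psubset_card_mono) auto
    with assms(5) show False by simp
  qed
  moreover have "idx (u t) \<noteq> idx (w t)"
    using t(2) inj_idx by (simp add: inj_eq)
  ultimately have "idx (w t) < idx (u t)"
    by simp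
  then show ?thesis
    unfolding lex_less_def using t by (intro bexI[of _ t]) auto
qed

text \<open>The colour of a position is one less than the length of a longest decreasing subsequence
  ending there.\<close>

lemma decreasing_or_colouring:
  obtains (decreasing) S where "S \<subseteq> P" "card S = Suc r" "decreasing_on S w"
  | (colouring) a where "\<And>p. p \<in> P \<Longrightarrow> a p < r"
      "\<And>s t. s \<in> P \<Longrightarrow> t \<in> P \<Longrightarrow> a s = a t \<Longrightarrow> ord s < ord t \<Longrightarrow> idx (w s) \<le> idx (w t)"
proof -
  \<comment> \<open>Decreasing subsequences with last position \<open>t\<close>.\<close>
  define chains where
    "chains t = {S. S \<subseteq> P \<and> t \<in> S \<and> (\<forall>s\<in>S. ord s \<le> ord t) \<and> decreasing_on S w}" for t
  define len where "len t = Max (card ` chains t)" for t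
  have fin: "finite (card ` chains t)" for t
    by (rule finite_imageI, rule finite_subset[of _ "Pow P"]) (auto simp: chains_def finite_P)
  have single: "{t} \<in> chains t" if "t \<in> P" for t
    using that by (auto simp: chains_def decreasing_on_def)
  have attained: "\<exists>S\<in>chains t. card S = len t" if "t \<in> P" for t
    using Max_in[OF fin, of t] single[OF that] unfolding len_def by fastforce
  have upper: "card S \<le> len t" if "S \<in> chains t" for S t
    using that fin unfolding len_def by simp
  have pos: "1 \<le> len t" if "t \<in> P" for t
    using upper[OF single[OF that]] by simp
  show thesis
  proof (cases "\<exists>t\<in>P. r < len t")
    case True
    then obtain t S where "t \<in> P" "S \<in> chains t" "Suc r \<le> card S"
      using attained by (metis Suc_leI)
    then obtain T where "T \<subseteq> S" "card T = Suc r"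
      by (meson obtain_subset_with_card_n)
    moreover have "S \<subseteq> P" "decreasing_on S w"
      using \<open>S \<in> chains t\<close> by (auto simp: chains_def)
    ultimately show thesis
      by (intro decreasing[of T]) (auto simp: decreasing_on_def)
  next
    case False
    show thesis
    proof (rule colouring[of "\<lambda>p. len p - 1"])
      \<comment> \<open>Lengths lie between 1 and \<open>r\<close>, so subtracting 1 gives colours
        below \<open>r\<close>.\<close>
      show "len p - 1 < r" if "p \<in> P" for p
        using False pos[OF that] that by force
    next
      fix s t assume st: "s \<in> P" "t \<in> P" "len s - 1 = len t - 1" "ord s < ord t"
      show "idx (w s) \<le> idx (w t)"
      proof (rule ccontr)
        assume "\<not> idx (w s) \<le> idx (w t)"
        then have less: "idx (w t) < idx (w s)" by simp
        obtain S where S: "S \<in> chains s" "card S = len s"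
          using attained st(1) by blast
        have below: "ord x < ord t \<and> idx (w t) < idx (w x)" if "x \<in> S" for x
        proof -
          have "x \<in> P" "ord x \<le> ord s"
            using S(1) that by (auto simp: chains_def)
          moreover have "idx (w s) \<le> idx (w x)"
          proof (cases "x = s")
            case False
            then have "ord x < ord s"
              using \<open>x \<in> P\<close> \<open>ord x \<le> ord s\<close> st(1) inj_ord by (metis inj_onD le_neq_implies_less)
            with S(1) that show ?thesis
              by (force simp: chains_def decreasing_on_def)
          qed simp
          ultimately show ?thesis
            using less st(4) by simp
        qed
        \<comment> \<open>A longest chain ending at \<open>s\<close> is prolonged by
          \<open>t\<close>, so \<open>len t\<close> would exceed \<open>len s\<close>.\<close>
        have "insert t S \<in> chains t"
          using S(1) below st(2) unfolding chains_def decreasing_on_def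
          by (auto simp: less_imp_le) (meson less_asym)+
        moreover have "t \<notin> S" "finite S"
          using below S(1) finite_P by (auto simp: chains_def intro: finite_subset)
        ultimately have "Suc (len s) \<le> len t"
          using upper[of "insert t S" t] S(2) by simp
        with st(3) pos[OF st(1)] pos[OF st(2)] show False
          by simp
      qed
    qed
  qed
qed

end

section \<open>The multilinear second fundamental theorem\<close>

context ordered_words
begin

lemma sum_permuted_words:
  fixes X :: "('p \<Rightarrow> 'a) \<Rightarrow> 'r :: comm_ring_1"
  assumes "w \<in> words" "S \<subseteq> P"
  shows "(\<Sum>u\<in>words. of_int (\<Sum>\<sigma> | \<sigma> permutes S \<and> w \<circ> \<sigma> = u. sign \<sigma>) * X u) =
         (\<Sum>\<sigma> | \<sigma> permutes S. of_int (sign \<sigma>) * X (w \<circ> \<sigma>))"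
proof -
  have "finite S"
    using assms(2) finite_P finite_subset by blast
  then have fin: "finite {\<sigma>. \<sigma> permutes S}"
    by (rule finite_permutations)
  have "(\<Sum>\<sigma> | \<sigma> permutes S. of_int (sign \<sigma>) * X (w \<circ> \<sigma>)) =
        (\<Sum>u\<in>words. \<Sum>\<sigma> | \<sigma> \<in> {\<sigma>. \<sigma> permutes S} \<and> w \<circ> \<sigma> = u. of_int (sign \<sigma>) * X (w \<circ> \<sigma>))"
    by (rule sum.group[symmetric, OF fin finite_words])
      (use comp_permutes_in_words[OF assms] in auto)
  also have "\<dots> = (\<Sum>u\<in>words. of_int (\<Sum>\<sigma> | \<sigma> permutes S \<and> w \<circ> \<sigma> = u. sign \<sigma>) * X u)"
    by (intro sum.cong refl) (simp add: sum_distrib_right)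
  finally show ?thesis ..
qed

text \<open>The form with coefficients \<open>c\<close> is evaluated by inserting the vector
  \<open>g (a p)\<close> at position \<open>p\<close>, so \<open>vanishing\<close> concerns tuples
  with at most \<open>r\<close> distinct vectors. The closure properties of \<open>I\<close> are
  those of an ideal, \<open>C\<close> embeds the scalars, and \<phi> interprets words in the
  ring.\<close>

lemma multilinear_second_fundamental_theorem:
  fixes c :: "('p \<Rightarrow> 'a) \<Rightarrow> complex" and \<phi> :: "('p \<Rightarrow> 'a) \<Rightarrow> 'r :: comm_ring_1"
    and C :: "complex \<Rightarrow> 'r"
  assumes I_0: "0 \<in> I" and I_add: "\<And>x y. x \<in> I \<Longrightarrow> y \<in> I \<Longrightarrow> x + y \<in> I"
    and I_mult: "\<And>x y. x \<in> I \<Longrightarrow> y * x \<in> I"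
    and C_diff: "\<And>x y. C (x - y) = C x - C y" and C_mult: "\<And>x y. C (x * y) = C x * C y"
    and C_int: "\<And>k. C (of_int k) = of_int k"
    and antisymmetriser: "\<And>w S. w \<in> words \<Longrightarrow> S \<subseteq> P \<Longrightarrow> card S = Suc r \<Longrightarrow>
          (\<Sum>\<sigma> | \<sigma> permutes S. of_int (sign \<sigma>) * \<phi> (w \<circ> \<sigma>)) \<in> I"
    and vanishing: "\<And>a :: 'p \<Rightarrow> nat. \<And>g. (\<And>p. p \<in> P \<Longrightarrow> a p < r) \<Longrightarrow>
          (\<Sum>w\<in>words. c w * (\<Prod>p\<in>P. g (a p) (w p))) = 0"
  shows "(\<Sum>w\<in>words. C (c w) * \<phi> w) \<in> I"
proof -
  have C_0: "C 0 = 0"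
    using C_int[of 0] by simp
  \<comment> \<open>The claim is generalised to all \<open>c\<close>, since each reduction changes
    the coefficients; \<open>K\<close> bounds the ranks of the words that still occur.\<close>
  have "(\<Sum>w\<in>words. C (c w) * \<phi> w) \<in> I"
    if "\<And>w. w \<in> words \<Longrightarrow> K \<le> lex_rank w \<Longrightarrow> c w = 0"
      and "\<And>a :: 'p \<Rightarrow> nat. \<And>g. (\<And>p. p \<in> P \<Longrightarrow> a p < r) \<Longrightarrow>
          (\<Sum>w\<in>words. c w * (\<Prod>p\<in>P. g (a p) (w p))) = 0"
    for K c
    using that
  proof (induction K arbitrary: c)
    case 0
    then show ?case
      by (simp add: C_0 I_0)
  next
    case (Suc K)
    show ?case
    proof (cases "\<exists>w\<in>words. lex_rank w = K \<and> c w \<noteq> 0")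
      case False
      with Suc.prems(1) have "c w = 0" if "w \<in> words" "K \<le> lex_rank w" for w
        using that by (metis le_neq_implies_less Suc_leI)
      then show ?thesis
        by (rule Suc.IH[OF _ Suc.prems(2)])
    next
      case True
      then obtain w\<^sub>0 where w\<^sub>0: "w\<^sub>0 \<in> words" "lex_rank w\<^sub>0 = K" "c w\<^sub>0 \<noteq> 0"
        by blast
      show ?thesis
      proof (cases rule: decreasing_or_colouring[of r w\<^sub>0])
        case (decreasing S)
        \<comment> \<open>\<open>A\<close> holds the coefficients of the antisymmetriser of the
          leading word; \<open>c'\<close> subtracts the multiple that cancels this word.\<close>
        define A where "A u = (\<Sum>\<sigma> | \<sigma> permutes S \<and> w\<^sub>0 \<circ> \<sigma> = u. sign \<sigma>)" for u
        define c' where "c' u = c u - c w\<^sub>0 * of_int (A u)" for u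
        note sum_A = sum_permuted_words[OF w\<^sub>0(1) decreasing(1), folded A_def]
        have lower: "lex_less (w\<^sub>0 \<circ> \<sigma>) w\<^sub>0" if "\<sigma> permutes S" "\<sigma> \<noteq> id" for \<sigma>
          using lex_less_comp_permutes decreasing(1,3) that by blast
        \<comment> \<open>Only the identity fixes the leading word, so its coefficient in the
          antisymmetriser is exactly 1.\<close>
        have "{\<sigma>. \<sigma> permutes S \<and> w\<^sub>0 \<circ> \<sigma> = w\<^sub>0} = {id}"
          using lower lex_less_irrefl by (force simp: permutes_id)
        then have A_w\<^sub>0: "A w\<^sub>0 = 1"
          unfolding A_def by (simp add: sign_id)
        have "(\<Sum>w\<in>words. C (c' w) * \<phi> w) \<in> I"
        proof (rule Suc.IH)
          fix w assume w: "w \<in> words" "K \<le> lex_rank w"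
          show "c' w = 0"
          proof (cases "w = w\<^sub>0")
            case True
            then show ?thesis by (simp add: c'_def A_w\<^sub>0)
          next
            case False
            then have "lex_rank w \<noteq> K"
              using lex_rank_eq_imp_eq w\<^sub>0 w(1) by metis
            then have "c w = 0"
              using Suc.prems(1)[OF w(1)] w(2) by simp
            moreover have "\<not> (\<sigma> permutes S \<and> w\<^sub>0 \<circ> \<sigma> = w)" for \<sigma>
            proof
              assume \<sigma>: "\<sigma> permutes S \<and> w\<^sub>0 \<circ> \<sigma> = w"
              then have "\<sigma> \<noteq> id"
                using False by auto
              then have "lex_less w w\<^sub>0"
                using lower \<sigma> by blast
              then show False
                using lex_rank_less w w\<^sub>0(2) by fastforce
            qed
            then have no_terms: "{\<sigma>. \<sigma> permutes S \<and> w\<^sub>0 \<circ> \<sigma> = w} = {}"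
              by blast
            have "A w = 0"
              unfolding A_def no_terms by simp
            ultimately show ?thesis by (simp add: c'_def)
          qed
        next
          fix a :: "'p \<Rightarrow> nat" and g :: "nat \<Rightarrow> 'a \<Rightarrow> complex"
          assume a: "\<And>p. p \<in> P \<Longrightarrow> a p < r"
          have "finite S"
            using decreasing(1) finite_P finite_subset by blast
          \<comment> \<open>Only \<open>r\<close> vectors fill the \<open>r + 1\<close> positions of
            \<open>S\<close>, so two positions share one. Swapping them keeps the value, hence the
            antisymmetriser evaluates to 0.\<close>
          have "card (a ` S) \<le> card {..<r}"
            using a decreasing(1) by (intro card_mono) auto
          then have "\<not> inj_on a S"
            using decreasing(2) pigeonhole[of a S] by auto
          then obtain x y where xy: "x \<in> S" "y \<in> S" "x \<noteq> y" "a x = a y"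
            by (auto simp: inj_on_def)
          define G where "G u = (\<Prod>p\<in>P. g (a p) (u p))" for u
          have G_swap: "G (u \<circ> Transposition.transpose x y) = G u" for u
          proof -
            have "Transposition.transpose x y permutes P"
              using xy decreasing(1) by (intro permutes_swap_id) auto
            then have "G u = (\<Prod>p\<in>P. g (a (Transposition.transpose x y p)) (u (Transposition.transpose x y p)))"
              unfolding G_def by (subst prod.permute[of "Transposition.transpose x y"]) (simp_all add: comp_def)
            also have "\<dots> = G (u \<circ> Transposition.transpose x y)"
              unfolding G_def using xy(4) by (intro prod.cong) (auto simp: Transposition.transpose_def)
            finally show ?thesis ..
          qed
          have "(\<Sum>w\<in>words. of_int (A w) * G w) = 0"
            unfolding sum_A
            by (rule sum_sign_eq_0[OF xy(1,2,3) \<open>finite S\<close>]) (simp add: G_swap flip: comp_assoc)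
          moreover have "(\<Sum>w\<in>words. c' w * G w) =
              (\<Sum>w\<in>words. c w * G w) - c w\<^sub>0 * (\<Sum>w\<in>words. of_int (A w) * G w)"
            by (simp add: c'_def algebra_simps sum_subtractf sum_distrib_left)
          ultimately show "(\<Sum>w\<in>words. c' w * (\<Prod>p\<in>P. g (a p) (w p))) = 0"
            using Suc.prems(2)[OF a] by (simp add: G_def)
        qed
        moreover have "C (c w\<^sub>0) * (\<Sum>w\<in>words. of_int (A w) * \<phi> w) \<in> I"
          unfolding sum_A by (intro I_mult antisymmetriser w\<^sub>0 decreasing)
        moreover have "(\<Sum>w\<in>words. C (c w) * \<phi> w) =
            (\<Sum>w\<in>words. C (c' w) * \<phi> w) + C (c w\<^sub>0) * (\<Sum>w\<in>words. of_int (A w) * \<phi> w)"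
          by (simp add: c'_def C_diff C_mult C_int algebra_simps sum_subtractf sum_distrib_left)
        ultimately show ?thesis
          using I_add by simp
      next
        case (colouring a)
        \<comment> \<open>Letting the \<open>r\<close> vectors vary turns the value into a
          polynomial in their coordinates, where the word \<open>w\<close> contributes to the
          monomial \<open>content a w\<close>.\<close>
        have "(\<Sum>w\<in>words. c w * (\<Prod>v\<in>#content a w. x v)) = 0" for x
          using Suc.prems(2)[of a "\<lambda>q y. x (q, y)"] colouring(1)
          by (simp add: content_def prod_unfold_prod_mset image_mset.compositionality comp_def)
        then have "(\<Sum>w | w \<in> words \<and> content a w = content a w\<^sub>0. c w) = 0"
          by (rule monomial_coefficient_zero[OF finite_words])
        \<comment> \<open>Any other word with this content is larger than the leading one, so its
          coefficient is already 0.\<close>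
        moreover have "c w = 0" if "w \<in> words" "content a w = content a w\<^sub>0" "w \<noteq> w\<^sub>0" for w
        proof -
          have "lex_less w\<^sub>0 w"
            using lex_less_of_content_eq[of a w\<^sub>0 w] colouring(2) that w\<^sub>0(1) by blast
          then have "K < lex_rank w"
            using lex_rank_less w\<^sub>0 by blast
          then show ?thesis
            using Suc.prems(1) that(1) by simp
        qed
        then have "(\<Sum>w | w \<in> words \<and> content a w = content a w\<^sub>0. c w) = (\<Sum>w\<in>{w\<^sub>0}. c w)"
          using w\<^sub>0(1) finite_words by (intro sum.mono_neutral_right) auto
        ultimately show ?thesis
          using w\<^sub>0(3) by simp
      qed
    qed
  qed
  \<comment> \<open>Beyond the maximal rank the condition involving \<open>K\<close> is
    vacuous.\<close>
  from this[of "Suc (Max (lex_rank ` words))" c] vanishing show ?thesis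
    using Max_ge[OF finite_imageI[OF finite_words], of _ lex_rank] by (meson Suc_n_not_le_n dual_order.trans imageI)
qed

end

section \<open>Polynomials and vanishing of the minors\<close>

lemma poly_eval_superset:
  assumes "finite E" "Poly_Mapping.keys p \<subseteq> E"
  shows "poly_eval x p =
    (\<Sum>e\<in>E. Poly_Mapping.lookup p e * (\<Prod>v\<in>UNIV. (x $ v) ^ Poly_Mapping.lookup e v))"
  unfolding poly_eval_def using assms
  by (intro sum.mono_neutral_left) (auto simp: in_keys_iff)

lemma poly_eval_single:
  "poly_eval x (Poly_Mapping.single e a) = a * (\<Prod>v\<in>UNIV. (x $ v) ^ Poly_Mapping.lookup e v)"
  by (subst poly_eval_superset[of "{e}"]) auto

lemma poly_eval_zero [simp]: "poly_eval x 0 = 0"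
  by (simp add: poly_eval_def)

lemma poly_eval_add: "poly_eval x (p + q) = poly_eval x p + poly_eval x q"
proof -
  let ?E = "Poly_Mapping.keys p \<union> Poly_Mapping.keys q"
  have "finite ?E" "Poly_Mapping.keys (p + q) \<subseteq> ?E"
    using keys_add[of p q] by auto
  then show ?thesis
    by (simp add: poly_eval_superset[of ?E] lookup_add distrib_right sum.distrib)
qed

lemma poly_eval_sum: "poly_eval x (sum f A) = (\<Sum>a\<in>A. poly_eval x (f a))"
  by (induction A rule: infinite_finite_induct) (auto simp: poly_eval_add)

lemma poly_eq_sum_monomials:
  "p = (\<Sum>e\<in>Poly_Mapping.keys p. Poly_Mapping.single e (Poly_Mapping.lookup p e))"
  by (rule poly_mapping_eqI) (auto simp: lookup_sum lookup_single when_def in_keys_iff)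

lemma poly_eval_mult: "poly_eval x (p * q) = poly_eval x p * poly_eval x q"
proof -
  have "poly_eval x (Poly_Mapping.single e a * Poly_Mapping.single e' b) =
        poly_eval x (Poly_Mapping.single e a) * poly_eval x (Poly_Mapping.single e' b)" for e e' a b
    by (simp add: mult_single poly_eval_single lookup_add power_add prod.distrib)
  then have "poly_eval x
      ((\<Sum>e\<in>Poly_Mapping.keys p. Poly_Mapping.single e (Poly_Mapping.lookup p e)) *
       (\<Sum>e\<in>Poly_Mapping.keys q. Poly_Mapping.single e (Poly_Mapping.lookup q e))) =
      poly_eval x (\<Sum>e\<in>Poly_Mapping.keys p. Poly_Mapping.single e (Poly_Mapping.lookup p e)) *
      poly_eval x (\<Sum>e\<in>Poly_Mapping.keys q. Poly_Mapping.single e (Poly_Mapping.lookup q e))"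
    by (simp add: sum_product poly_eval_sum)
  then show ?thesis
    by (simp only: poly_eq_sum_monomials[symmetric])
qed

lemma poly_eval_one: "poly_eval x 1 = 1"
  using poly_eval_single[of x 0 1] by simp

interpretation poly_eval: comm_ring_hom "poly_eval x" for x
  by standard (simp_all add: poly_eval_add poly_eval_mult poly_eval_one)

text \<open>Induction on the total degree splits off one variable at a time. Factors are listed with
  repetition, because polarisation treats each occurrence separately.\<close>

lemma monomial_eq_prod_Var:
  obtains d :: nat and v where "Poly_Mapping.single e 1 = (\<Prod>s<d. Var (v s) :: ('v :: finite) mpolynomial)"
proof -
  have "\<exists>(d :: nat) v. Poly_Mapping.single e 1 = (\<Prod>s<d. Var (v s) :: 'v mpolynomial)"
    if "(\<Sum>u\<in>UNIV. Poly_Mapping.lookup e u) = N" for N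
    using that
  proof (induction N arbitrary: e)
    case 0
    then have "e = 0"
      by (intro poly_mapping_eqI) simp
    then show ?case
      by (intro exI[of _ "0 :: nat"]) simp
  next
    case (Suc N)
    then obtain u where u: "Poly_Mapping.lookup e u \<noteq> 0"
      by (metis Zero_not_Suc sum.neutral)
    define e' where "e' = e - Poly_Mapping.single u 1"
    have e: "e = e' + Poly_Mapping.single u 1"
      using u by (intro poly_mapping_eqI) (auto simp: e'_def lookup_add lookup_minus lookup_single when_def)
    then have "(\<Sum>u\<in>UNIV. Poly_Mapping.lookup e' u) = N"
      using Suc.prems by (simp add: lookup_add sum.distrib lookup_single when_def)
    then obtain d :: nat and v where "Poly_Mapping.single e' 1 = (\<Prod>s<d. Var (v s) :: 'v mpolynomial)"
      using Suc.IH by blast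
    moreover have "Poly_Mapping.single e 1 = Poly_Mapping.single e' (1 :: complex) * Var u"
      by (simp add: e Var_def mult_single)
    ultimately have "Poly_Mapping.single e 1 = (\<Prod>s<Suc d. Var ((v(d := u)) s) :: 'v mpolynomial)"
      by simp
    then show ?case by blast
  qed
  with that show thesis by blast
qed

text \<open>Every row of a slice of \<open>pure_tensor u v w\<close> is a combination of
  \<open>v\<close> and \<open>w\<close>, and this passes to the span.\<close>

lemma tensor_sym2_slice_row:
  fixes x :: "('m::finite, 'n::finite) sym_tensor"
  assumes "vec.subspace B" "x \<in> tensor_sym2 A B"
  shows "(\<chi> k. x $ (i, Upair j k)) \<in> B"
  using assms(2) unfolding tensor_sym2_def
proof (induction rule: vec.span_induct_alt)
  case base
  have "(\<chi> k. 0) = (0 :: complex ^ 'n)"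
    by (simp add: Finite_Cartesian_Product.vec_eq_iff)
  then show ?case
    using vec.subspace_0[OF assms(1)] by simp
next
  case (step c y z)
  then obtain u v w where y: "y = pure_tensor u v w" "v \<in> B" "w \<in> B"
    by blast
  have "(\<chi> k. (c *s y + z) $ (i, Upair j k)) =
      (c * u $ i / 2 * v $ j) *s w + (c * u $ i / 2 * w $ j) *s v + (\<chi> k. z $ (i, Upair j k))"
    by (simp add: Finite_Cartesian_Product.vec_eq_iff y(1) pure_tensor_def field_simps)
  then show ?case
    using y(2,3) step(2) assms(1) by (simp add: vec.subspace_add vec.subspace_scale)
qed

text \<open>All rows of the flattening of \<open>x\<close> lie in a space of dimension
  \<open>r\<close>. Expanding them in a basis factors every submatrix of size \<open>r + 1\<close>
  through dimension \<open>r\<close>.\<close>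

lemma minors_vanish_on_subspace_variety:
  fixes x :: "('m::finite, 'n::finite) sym_tensor"
  assumes "x \<in> subspace_variety m r" "p \<in> minors (r + 1) (flattening Var)"
  shows "poly_eval x p = 0"
proof -
  obtain A B where B: "vec.subspace B" "vec.dim B = r" "x \<in> tensor_sym2 A B"
    using assms(1) by (auto simp: subspace_variety_def)
  obtain \<rho> :: "nat \<Rightarrow> 'm \<times> 'n" and \<gamma> :: "nat \<Rightarrow> 'n" where
    p: "p = Determinant.det (Matrix.mat (r + 1) (r + 1) (\<lambda>(a, b). flattening Var $ \<rho> a $ \<gamma> b))"
    using assms(2) unfolding minors_def by blast
  define row where "row a = (\<chi> k. x $ (fst (\<rho> a), Upair (snd (\<rho> a)) k))" for a
  obtain S where S: "S \<subseteq> B" "vec.independent S" "B \<subseteq> vec.span S" "card S = r"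
    using vec.basis_exists[of B] B(2) by metis
  have "finite S"
    using S(2) by (rule vec.finiteI_independent)
  then obtain \<beta> where \<beta>: "bij_betw \<beta> {..<r} S"
    using ex_bij_betw_nat_finite[of S] S(4) by (auto simp: lessThan_atLeast0)
  have "\<exists>l. row a = (\<Sum>v\<in>S. l v *s v)" for a
  proof -
    have "row a \<in> vec.span S"
      using tensor_sym2_slice_row[OF B(1,3)] S(3) by (auto simp: row_def)
    then show ?thesis
      using vec.span_finite[OF \<open>finite S\<close>] by auto
  qed
  then obtain l where l: "\<And>a. row a = (\<Sum>v\<in>S. l a v *s v)"
    by metis
  \<comment> \<open>The inner dimension \<open>r\<close> is padded to \<open>r + 1\<close> by a zero
    column of \<open>L\<close> and a zero row of \<open>R\<close>, so that both factors are square
    and determinants multiply.\<close>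
  define L where "L = Matrix.mat (r + 1) (r + 1) (\<lambda>(a, q). if q < r then l a (\<beta> q) else 0)"
  define R where "R = Matrix.mat (r + 1) (r + 1) (\<lambda>(q, b). if q < r then \<beta> q $ \<gamma> b else 0)"
  have carrier: "L \<in> carrier_mat (r + 1) (r + 1)" "R \<in> carrier_mat (r + 1) (r + 1)"
    by (simp_all add: L_def R_def)
  have "x $ (fst (\<rho> a), Upair (snd (\<rho> a)) (\<gamma> b)) = (\<Sum>q<r. l a (\<beta> q) * \<beta> q $ \<gamma> b)" for a b
  proof -
    have "x $ (fst (\<rho> a), Upair (snd (\<rho> a)) (\<gamma> b)) = row a $ \<gamma> b"
      by (simp add: row_def)
    also have "\<dots> = (\<Sum>v\<in>S. l a v * v $ \<gamma> b)"
      by (simp add: l sum_component)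
    also have "\<dots> = (\<Sum>q<r. l a (\<beta> q) * \<beta> q $ \<gamma> b)"
      by (rule sum.reindex_bij_betw[OF \<beta>, symmetric])
    finally show ?thesis .
  qed
  then have "map_mat (poly_eval x)
      (Matrix.mat (r + 1) (r + 1) (\<lambda>(a, b). flattening Var $ \<rho> a $ \<gamma> b)) = L * R"
    by (intro eq_matI) (auto simp: L_def R_def scalar_prod_def flattening_def slice_def lessThan_atLeast0)
  then have "poly_eval x p = Determinant.det L * Determinant.det R"
    unfolding p poly_eval.hom_det[symmetric] using det_mult[OF carrier] by simp
  also have "Determinant.det R = 0"
    using laplace_expansion_row[OF carrier(2), of r] by (simp add: R_def)
  finally show ?thesis
    by simp
qed

section \<open>Ideal membership and the easy inclusion\<close>

lemma module_mult: "Modules.module ((*) :: 'r :: comm_ring_1 \<Rightarrow> 'r \<Rightarrow> 'r)"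
  by standard (auto simp: algebra_simps)

lemma ideal_generated_0: "0 \<in> ideal_generated S"
  unfolding ideal_generated_def by (rule module.span_zero[OF module_mult])

lemma ideal_generated_add: "p \<in> ideal_generated S \<Longrightarrow> q \<in> ideal_generated S \<Longrightarrow> p + q \<in> ideal_generated S"
  unfolding ideal_generated_def by (rule module.span_add[OF module_mult])

lemma ideal_generated_mult: "p \<in> ideal_generated S \<Longrightarrow> q * p \<in> ideal_generated S"
  unfolding ideal_generated_def by (rule module.span_scale[OF module_mult])

lemma ideal_generated_base: "p \<in> S \<Longrightarrow> p \<in> ideal_generated S"
  unfolding ideal_generated_def by (rule module.span_base[OF module_mult])

lemma I_kappa0_le_subset_vanishing_ideal:
  "I_kappa0_le r \<subseteq> vanishing_ideal (subspace_variety m r :: ('m::finite, 'n::finite) sym_tensor set)"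
proof
  fix p :: "('m \<times> 'n uprod) mpolynomial" assume "p \<in> I_kappa0_le r"
  then obtain T c where "p = (\<Sum>a\<in>T. c a * a)" "T \<subseteq> minors (r + 1) (flattening Var)"
    unfolding I_kappa0_le_def ideal_generated_eq by blast
  then show "p \<in> vanishing_ideal (subspace_variety m r :: ('m, 'n) sym_tensor set)"
    using minors_vanish_on_subspace_variety
    by (fastforce simp: vanishing_ideal_def poly_eval_sum poly_eval_mult intro!: sum.neutral)
qed

section \<open>Antisymmetrisers and minors\<close>

text \<open>This is the Leibniz formula for a matrix indexed by a finite set: the enumeration
  \<open>h\<close> transports permutations of \<open>{..<k}\<close> to those of \<open>S\<close> and
  keeps their signs.\<close>

lemma det_eq_sum_permutations:
  fixes N :: "'p \<Rightarrow> 'p \<Rightarrow> 'r :: comm_ring_1"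
  assumes h: "bij_betw h {..<k} S"
  shows "(\<Sum>\<sigma> | \<sigma> permutes S. of_int (sign \<sigma>) * (\<Prod>x\<in>S. N x (\<sigma> x))) =
         Determinant.det (Matrix.mat k k (\<lambda>(i, j). N (h i) (h j)))"
proof -
  have inj: "inj_on h {..<k}" and image: "h ` {..<k} = S"
    using h by (auto simp: bij_betw_def)
  have map: "map_permutation {..<k} h \<pi> = (\<lambda>x. if x \<in> S then h (\<pi> (inv_into {..<k} h x)) else x)" for \<pi>
    by (auto simp: map_permutation_def restrict_id_def image)
  have "(\<Sum>\<sigma> | \<sigma> permutes S. of_int (sign \<sigma>) * (\<Prod>x\<in>S. N x (\<sigma> x))) =
        (\<Sum>\<pi> | \<pi> permutes {..<k}. of_int (sign (map_permutation {..<k} h \<pi>)) *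
           (\<Prod>x\<in>S. N x (map_permutation {..<k} h \<pi> x)))"
    unfolding map by (rule sum.reindex_bij_betw[OF bij_betw_permutations[OF h], symmetric])
  also have "\<dots> = (\<Sum>\<pi> | \<pi> permutes {..<k}. of_int (sign \<pi>) * (\<Prod>i<k. N (h i) (h (\<pi> i))))"
  proof (intro sum.cong refl)
    fix \<pi> assume "\<pi> \<in> {\<pi>. \<pi> permutes {..<k}}"
    then have \<pi>: "\<pi> permutes {..<k}" by simp
    have "(\<Prod>x\<in>S. N x (map_permutation {..<k} h \<pi> x)) =
          (\<Prod>i<k. N (h i) (map_permutation {..<k} h \<pi> (h i)))"
      by (rule prod.reindex_bij_betw[OF h, symmetric])
    also have "\<dots> = (\<Prod>i<k. N (h i) (h (\<pi> i)))"
      using image by (intro prod.cong) (auto simp: map inv_into_f_f[OF inj])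
    finally show "of_int (sign (map_permutation {..<k} h \<pi>)) *
        (\<Prod>x\<in>S. N x (map_permutation {..<k} h \<pi> x)) =
        of_int (sign \<pi>) * (\<Prod>i<k. N (h i) (h (\<pi> i)))"
      using sign_map_permutation[OF inj \<pi>] by simp
  qed
  also have "\<dots> = Determinant.det (Matrix.mat k k (\<lambda>(i, j). N (h i) (h j)))"
    by (subst det_def'[of _ k]) (auto simp: lessThan_atLeast0 intro!: sum.cong prod.cong dest: permutes_in_image)
  finally show ?thesis .
qed

text \<open>Antisymmetrisers can produce index choices that are not injective; these repeat a row or
  a column, and the determinant is 0.\<close>

lemma det_in_ideal_generated_minors:
  "Determinant.det (Matrix.mat k k (\<lambda>(a, b). M $ \<rho> a $ \<gamma> b)) \<in> ideal_generated (minors k M)"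
    (is "Determinant.det ?A \<in> _")
proof (cases "inj_on \<rho> {..<k} \<and> inj_on \<gamma> {..<k}")
  case True
  then have "Determinant.det ?A \<in> minors k M"
    unfolding minors_def by blast
  then show ?thesis
    by (rule ideal_generated_base)
next
  case False
  have A: "?A \<in> carrier_mat k k"
    by simp
  have "Determinant.det ?A = 0"
  proof (cases "inj_on \<rho> {..<k}")
    case True
    then obtain i j where "i < k" "j < k" "i \<noteq> j" "\<gamma> i = \<gamma> j"
      using False by (auto simp: inj_on_def)
    then have "Determinant.det ?A\<^sup>T = 0"
      by (intro det_identical_rows[of _ k i j]) (auto intro!: eq_vecI)
    then show ?thesis
      by (simp add: det_transpose[OF A])
  next
    case not_inj: False
    then obtain i j where "i < k" "j < k" "i \<noteq> j" "\<rho> i = \<rho> j"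
      by (auto simp: inj_on_def)
    then show ?thesis
      by (intro det_identical_rows[OF A, of i j]) (auto intro!: eq_vecI)
  qed
  then show ?thesis
    by (simp add: ideal_generated_0)
qed

text \<open>Factor \<open>t\<close> has the two slots \<open>(t, False)\<close> and
  \<open>(t, True)\<close>, filled by letters of the word \<open>w\<close>. This turns the words of
  a multilinear form back into polynomials.\<close>

definition slot_monomial ::
    "nat \<Rightarrow> (nat \<Rightarrow> 'm) \<Rightarrow> (nat \<times> bool \<Rightarrow> 'n) \<Rightarrow> ('m::finite \<times> 'n::finite uprod) mpolynomial" where
  "slot_monomial d \<iota> w = (\<Prod>t<d. Var (\<iota> t, Upair (w (t, False)) (w (t, True))))"

lemma Upair_commute: "Upair j k = Upair k j"
  by simp

lemma slot_monomial_swap: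
  "slot_monomial d \<iota> (u \<circ> Transposition.transpose (t, False) (t, True)) = slot_monomial d \<iota> u"
  unfolding slot_monomial_def by (intro prod.cong) (auto simp: Transposition.transpose_def Upair_commute)

text \<open>
  Antisymmetrising over both slots of one factor gives zero because the slices are symmetric.
  Otherwise the chosen slots lie in distinct factors; the column index of each is antisymmetrised
  while the other slot of the factor supplies the row of a minor.
\<close>

lemma antisymmetriser_in_I_kappa0_le:
  assumes S: "S \<subseteq> {..<d} \<times> UNIV" "card S = Suc r"
  shows "(\<Sum>\<sigma> | \<sigma> permutes S. of_int (sign \<sigma>) * slot_monomial d \<iota> (w \<circ> \<sigma>)) \<in> I_kappa0_le r"
proof (cases "\<exists>t. (t, False) \<in> S \<and> (t, True) \<in> S")
  case True
  then obtain t where t: "(t, False) \<in> S" "(t, True) \<in> S"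
    by blast
  have "finite S"
    using S(1) by (rule finite_subset) simp
  then have "(\<Sum>\<sigma> | \<sigma> permutes S. of_int (sign \<sigma>) * slot_monomial d \<iota> (w \<circ> \<sigma>)) = 0"
    by (intro sum_sign_eq_0[OF t]) (simp_all add: slot_monomial_swap flip: comp_assoc)
  then show ?thesis
    by (simp add: I_kappa0_le_def ideal_generated_0)
next
  case False
  then have other: "(t, \<not> b) \<notin> S" if "(t, b) \<in> S" for t b
    using that by (cases b) auto
  have "inj_on fst S"
  proof (rule inj_onI)
    fix x y assume "x \<in> S" "y \<in> S" "fst x = fst y"
    then show "x = y"
      using other[of "fst x" "snd x"] by (cases x; cases y; cases "snd x"; cases "snd y") auto
  qed
  have "finite S"
    using S(1) by (rule finite_subset) simp
  then obtain h where h: "bij_betw h {..<Suc r} S"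
    using ex_bij_betw_nat_finite[of S] S(2) by (auto simp: lessThan_atLeast0)
  \<comment> \<open>The slot \<open>x\<close> supplies the column of an entry; the other slot of its
    factor, which \<sigma> does not move, supplies the row.\<close>
  define row where "row x = (\<iota> (fst x), w (fst x, \<not> snd x))" for x :: "nat \<times> bool"
  define N where "N x y = flattening Var $ row x $ w y" for x y
  define rest where "rest = (\<Prod>t\<in>{..<d} - fst ` S. Var (\<iota> t, Upair (w (t, False)) (w (t, True))))"
  have monomial: "slot_monomial d \<iota> (w \<circ> \<sigma>) = rest * (\<Prod>x\<in>S. N x (\<sigma> x))" if "\<sigma> permutes S" for \<sigma>
  proof -
    let ?f = "\<lambda>t. Var (\<iota> t, Upair ((w \<circ> \<sigma>) (t, False)) ((w \<circ> \<sigma>) (t, True)))"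
    have fixed: "\<sigma> x = x" if "x \<notin> S" for x
      using that \<open>\<sigma> permutes S\<close> by (simp add: permutes_not_in)
    have "slot_monomial d \<iota> (w \<circ> \<sigma>) = (\<Prod>t\<in>{..<d} - fst ` S. ?f t) * (\<Prod>t\<in>fst ` S. ?f t)"
      unfolding slot_monomial_def using S(1) by (intro prod.subset_diff) auto
    also have "(\<Prod>t\<in>{..<d} - fst ` S. ?f t) = rest"
      unfolding rest_def
    proof (intro prod.cong refl)
      fix t assume "t \<in> {..<d} - fst ` S"
      then have "(t, b) \<notin> S" for b
        by force
      then show "?f t = Var (\<iota> t, Upair (w (t, False)) (w (t, True)))"
        by (simp add: fixed)
    qed
    also have "(\<Prod>t\<in>fst ` S. ?f t) = (\<Prod>x\<in>S. ?f (fst x))"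
      using \<open>inj_on fst S\<close> by (simp add: prod.reindex)
    also have "\<dots> = (\<Prod>x\<in>S. N x (\<sigma> x))"
    proof (intro prod.cong refl)
      fix x assume "x \<in> S"
      moreover obtain t b where "x = (t, b)"
        by fastforce
      ultimately show "?f (fst x) = N x (\<sigma> x)"
        using fixed[OF other[of t b]]
        by (cases b) (auto simp: N_def row_def flattening_def slice_def Upair_commute)
    qed
    finally show ?thesis .
  qed
  have "(\<Sum>\<sigma> | \<sigma> permutes S. of_int (sign \<sigma>) * slot_monomial d \<iota> (w \<circ> \<sigma>)) =
      rest * (\<Sum>\<sigma> | \<sigma> permutes S. of_int (sign \<sigma>) * (\<Prod>x\<in>S. N x (\<sigma> x)))"
    unfolding sum_distrib_left by (intro sum.cong refl) (simp add: monomial mult_ac)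
  also have "\<dots> = rest * Determinant.det (Matrix.mat (Suc r) (Suc r) (\<lambda>(i, j). N (h i) (h j)))"
    by (simp only: det_eq_sum_permutations[OF h])
  also have "\<dots> \<in> I_kappa0_le r"
    using det_in_ideal_generated_minors[of "Suc r" "flattening Var" "row \<circ> h" "w \<circ> h"]
    by (simp add: I_kappa0_le_def N_def ideal_generated_mult)
  finally show ?thesis .
qed

section \<open>Polarisation\<close>

text \<open>Vectors outside the span are added until the dimension is exactly \<open>r\<close>, as
  \<open>subspace_variety\<close> demands.\<close>

lemma obtain_subspace_of_dim:
  fixes G :: "(complex ^ 'n::finite) set"
  assumes "vec.dim G \<le> r" "r \<le> CARD('n)"
  obtains B where "vec.subspace B" "vec.dim B = r" "G \<subseteq> B"
proof -
  have "\<exists>B. G \<subseteq> B \<and> vec.dim B = r"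
    using assms
  proof (induction r rule: dec_induct)
    case base
    then show ?case by blast
  next
    case (step k)
    then obtain B where B: "G \<subseteq> B" "vec.dim B = k"
      by auto
    have "vec.span B \<noteq> UNIV"
    proof
      assume "vec.span B = UNIV"
      then have "vec.dim B = CARD('n)"
        by (metis vec.dim_span vec_dim_card)
      with B(2) step show False by simp
    qed
    then obtain y where "y \<notin> vec.span B"
      by blast
    with B show ?case
      by (intro exI[of _ "insert y B"]) (auto simp: vec.dim_insert)
  qed
  then obtain B where "G \<subseteq> B" "vec.dim B = r"
    by blast
  then show thesis
    using that[of "vec.span B"] vec.span_superset[of B] by (auto simp: vec.subspace_span)
qed

definition slots :: "nat \<Rightarrow> (nat \<times> bool) set" where
  "slots d = {..<d} \<times> UNIV"

text \<open>The factor 2 cancels the denominator in \<open>sym_prod\<close>; the scalars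
  \<open>c t\<close> serve as the indeterminates of the polarisation.\<close>

definition combination ::
    "nat \<Rightarrow> (nat \<Rightarrow> 'm) \<Rightarrow> (nat \<times> bool \<Rightarrow> complex ^ 'n) \<Rightarrow> (nat \<Rightarrow> complex) \<Rightarrow>
     ('m::finite, 'n::finite) sym_tensor" where
  "combination d j v c =
    (\<Sum>t<d. (2 * c t) *s pure_tensor (axis (j t) 1) (v (t, False)) (v (t, True)))"

lemma combination_in_subspace_variety:
  assumes v: "\<And>p. p \<in> slots d \<Longrightarrow> v p \<in> G" and G: "finite G" "card G \<le> r"
    and r: "r \<le> CARD('n)"
  shows "combination d j v c \<in> (subspace_variety CARD('m) r :: ('m::finite, 'n::finite) sym_tensor set)"
proof -
  have "vec.dim G \<le> r"
    using vec.dim_le_card'[OF G(1)] G(2) by simp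
  then obtain B where B: "vec.subspace B" "vec.dim B = r" "G \<subseteq> B"
    using obtain_subspace_of_dim r by metis
  have "v (t, b) \<in> B" if "t < d" for t b
    using v[of "(t, b)"] B(3) that by (auto simp: slots_def)
  then have "combination d j v c \<in> tensor_sym2 UNIV B"
    unfolding combination_def tensor_sym2_def
    by (intro vec.span_sum vec.span_scale vec.span_base) blast
  moreover have "vec.dim (UNIV :: (complex ^ 'm) set) = CARD('m)"
    by (rule vec_dim_card)
  ultimately show ?thesis
    unfolding subspace_variety_def using B vec.subspace_UNIV by blast
qed

text \<open>Each product contributes two terms to a coordinate, one for either order of its vectors;
  the slot \<open>y\<close> names the vector that receives the index \<open>k\<close>.\<close>

lemma combination_component:
  "combination d j v c $ (i, Upair k l) =
    (\<Sum>y\<in>slots d. c (fst y) * (if i = j (fst y) then v y $ k * v (fst y, \<not> snd y) $ l else 0))"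
proof -
  have "(\<Sum>y\<in>slots d. c (fst y) * (if i = j (fst y) then v y $ k * v (fst y, \<not> snd y) $ l else 0)) =
      (\<Sum>t<d. \<Sum>b\<in>UNIV. c t * (if i = j t then v (t, b) $ k * v (t, \<not> b) $ l else 0))"
    unfolding slots_def sum.cartesian_product by (intro sum.cong) auto
  also have "\<dots> = combination d j v c $ (i, Upair k l)"
    unfolding combination_def sum_component
    by (intro sum.cong refl) (auto simp: pure_tensor_def axis_def UNIV_bool field_simps)
  finally show ?thesis ..
qed

text \<open>When factor \<open>s\<close> is matched with the slot \<open>\<tau> s\<close>, its slot
  \<open>(s, False)\<close> goes to \<open>\<tau> s\<close> and its slot \<open>(s, True)\<close> to
  the partner of \<open>\<tau> s\<close>.\<close>

definition twist :: "(nat \<Rightarrow> nat \<times> bool) \<Rightarrow> nat \<times> bool \<Rightarrow> nat \<times> bool" where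
  "twist \<tau> p = (fst (\<tau> (fst p)), snd p \<noteq> snd (\<tau> (fst p)))"

text \<open>These encode the signed permutations: factors are permuted, and the two slots of each
  may be exchanged.\<close>

definition arrangements :: "nat \<Rightarrow> (nat \<Rightarrow> nat \<times> bool) set" where
  "arrangements d = {\<tau> \<in> {..<d} \<rightarrow>\<^sub>E slots d. bij_betw (\<lambda>s. fst (\<tau> s)) {..<d} {..<d}}"

lemma finite_slots: "finite (slots d)"
  by (simp add: slots_def)

lemma finite_arrangements: "finite (arrangements d)"
proof (rule finite_subset)
  show "arrangements d \<subseteq> {..<d} \<rightarrow>\<^sub>E slots d"
    by (auto simp: arrangements_def)
  show "finite ({..<d} \<rightarrow>\<^sub>E slots d)"
    by (simp add: finite_PiE finite_slots)
qed

lemma arrangements_nonempty: "arrangements d \<noteq> {}"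
proof -
  have "(\<lambda>s\<in>{..<d}. (s, False)) \<in> arrangements d"
    by (auto simp: arrangements_def slots_def bij_betw_def inj_on_def image_iff)
  then show ?thesis by blast
qed

lemma bij_betw_twist:
  assumes "\<tau> \<in> arrangements d"
  shows "bij_betw (twist \<tau>) (slots d) (slots d)"
proof -
  have bij: "bij_betw (\<lambda>s. fst (\<tau> s)) {..<d} {..<d}"
    using assms by (simp add: arrangements_def)
  have "inj_on (twist \<tau>) (slots d)"
  proof (rule inj_onI)
    fix x y assume xy: "x \<in> slots d" "y \<in> slots d" "twist \<tau> x = twist \<tau> y"
    then have "fst x = fst y"
      using inj_onD[OF bij_betw_imp_inj_on[OF bij], of "fst x" "fst y"]
      by (auto simp: twist_def slots_def)
    with xy(3) show "x = y"
      by (auto simp: twist_def prod_eq_iff)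
  qed
  moreover have "twist \<tau> ` slots d \<subseteq> slots d"
    using bij_betw_imp_surj_on[OF bij] by (auto simp: twist_def slots_def)
  ultimately show ?thesis
    by (simp add: bij_betw_def endo_inj_surj finite_slots)
qed

definition rearranged :: "nat \<Rightarrow> (nat \<Rightarrow> nat \<times> bool) \<Rightarrow> (nat \<times> bool \<Rightarrow> 'n) \<Rightarrow> nat \<times> bool \<Rightarrow> 'n" where
  "rearranged d \<tau> w = (\<lambda>p\<in>slots d. w (inv_into (slots d) (twist \<tau>) p))"

lemma rearranged_twist:
  assumes "\<tau> \<in> arrangements d" "p \<in> slots d"
  shows "rearranged d \<tau> w (twist \<tau> p) = w p"
  using bij_betw_twist[OF assms(1)] assms(2)
  by (auto simp: rearranged_def bij_betw_def inv_into_f_f)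

text \<open>Permuting factors preserves a product, exchanging the slots of a factor preserves an
  unordered pair, and the hypothesis on \<open>j\<close> matches the first indices.\<close>

lemma slot_monomial_rearranged:
  assumes \<tau>: "\<tau> \<in> arrangements d" and j: "\<And>s. s < d \<Longrightarrow> \<iota> s = j (fst (\<tau> s))"
  shows "slot_monomial d j (rearranged d \<tau> w) = slot_monomial d \<iota> w"
proof -
  let ?u = "rearranged d \<tau> w"
  have "slot_monomial d j ?u =
      (\<Prod>s<d. Var (j (fst (\<tau> s)), Upair (?u (fst (\<tau> s), False)) (?u (fst (\<tau> s), True))))"
    unfolding slot_monomial_def using \<tau>
    by (intro prod.reindex_bij_betw[symmetric]) (simp add: arrangements_def)
  also have "\<dots> = slot_monomial d \<iota> w"
    unfolding slot_monomial_def
  proof (intro prod.cong refl)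
    fix s assume "s \<in> {..<d}"
    then have "w (s, b) = ?u (fst (\<tau> s), b \<noteq> snd (\<tau> s))" for b
      using rearranged_twist[OF \<tau>, of "(s, b)" w] by (simp add: slots_def twist_def)
    then show "Var (j (fst (\<tau> s)), Upair (?u (fst (\<tau> s), False)) (?u (fst (\<tau> s), True))) =
        Var (\<iota> s, Upair (w (s, False)) (w (s, True)))"
      using j[of s] \<open>s \<in> {..<d}\<close> by (cases "snd (\<tau> s)") (simp_all add: Upair_commute)
  qed
  finally show ?thesis .
qed

lemma bij_betw_of_image_mset_eq:
  assumes "finite A" "finite B" "image_mset f (mset_set A) = mset_set B"
  shows "bij_betw f A B"
proof -
  have "f ` A = B"
    using arg_cong[OF assms(3), of set_mset] assms(1,2) by simp
  moreover have "card A = card B"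
    using arg_cong[OF assms(3), of size] by simp
  ultimately show ?thesis
    using assms(1) by (simp add: bij_betw_def eq_card_imp_inj_on)
qed

text \<open>
  The full polarisation of \<open>f\<close> vanishes on tuples of products of vectors from an
  \<open>r\<close>-dimensional space, being the coefficient of \<open>c\<^sub>0 \<cdots> c\<^bsub>d-1\<^esub>\<close> in
  the value of \<open>f\<close> at a linear combination of these products.
\<close>

lemma polarisation_vanishes:
  fixes \<iota> :: "'e \<Rightarrow> nat \<Rightarrow> 'm::finite" and w :: "'e \<Rightarrow> nat \<times> bool \<Rightarrow> 'n::finite"
  assumes E: "finite E" and r: "r \<le> CARD('n)"
    and f: "\<And>x. x \<in> (subspace_variety CARD('m) r :: ('m, 'n) sym_tensor set) \<Longrightarrow>
        (\<Sum>e\<in>E. \<alpha> e * poly_eval x (slot_monomial (D e) (\<iota> e) (w e))) = 0"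
    and a: "\<And>p. p \<in> slots d \<Longrightarrow> a p < r"
  shows "(\<Sum>(e, \<tau>) | e \<in> E \<and> D e = d \<and> \<tau> \<in> arrangements d \<and> (\<forall>s<d. \<iota> e s = j (fst (\<tau> s))).
           \<alpha> e * (\<Prod>p\<in>slots d. g (a (twist \<tau> p)) (w e p))) = 0"
    (is "sum _ ?Q = 0")
proof -
  define v where "v p = (\<chi> k. g (a p) k)" for p
  \<comment> \<open>The share of slot \<open>y\<close> in the value of factor \<open>s\<close> at
    the combination, apart from the scalar \<open>c (fst y)\<close>.\<close>
  define H where "H e s y = (if \<iota> e s = j (fst y) then
      g (a y) (w e (s, False)) * g (a (fst y, \<not> snd y)) (w e (s, True)) else 0)" for e s y
  \<comment> \<open>Expanding the products of sums picks one slot for every factor of each monomial;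
    \<open>M\<close> records the resulting monomial in the scalars \<open>c t\<close>.\<close>
  define R where "R = (SIGMA e:E. {..<D e} \<rightarrow>\<^sub>E slots d)"
  define M where "M e \<tau> = image_mset (\<lambda>s. fst (\<tau> s)) (mset_set {..<D e})"
    for e and \<tau> :: "nat \<Rightarrow> nat \<times> bool"
  have fin_R: "finite R"
    unfolding R_def using E by (intro finite_SigmaI finite_PiE finite_slots) auto
  have "(\<Sum>q\<in>R. (\<alpha> (fst q) * (\<Prod>s<D (fst q). H (fst q) s (snd q s))) *
      (\<Prod>t\<in>#M (fst q) (snd q). c t)) = 0" for c
  proof -
    have "combination d j v c \<in> (subspace_variety CARD('m) r :: ('m, 'n) sym_tensor set)"
    proof (rule combination_in_subspace_variety)
      show "v p \<in> (\<lambda>q. \<chi> k. g q k) ` {..<r}" if "p \<in> slots d" for p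
        using a[OF that] by (auto simp: v_def)
      show "card ((\<lambda>q. \<chi> k. g q k) ` {..<r}) \<le> r"
        using card_image_le[of "{..<r}"] by simp
    qed (simp_all add: r)
    then have "0 = (\<Sum>e\<in>E. \<alpha> e * poly_eval (combination d j v c) (slot_monomial (D e) (\<iota> e) (w e)))"
      by (simp add: f)
    also have "\<dots> = (\<Sum>e\<in>E. \<alpha> e * (\<Prod>s<D e. \<Sum>y\<in>slots d. c (fst y) * H e s y))"
    proof -
      have "combination d j v c $ (\<iota> e s, Upair (w e (s, False)) (w e (s, True))) =
          (\<Sum>y\<in>slots d. c (fst y) * H e s y)" for e s
        unfolding combination_component by (intro sum.cong refl) (simp add: H_def v_def)
      then show ?thesis
        by (simp add: slot_monomial_def poly_eval.hom_prod)
    qed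
    also have "\<dots> = (\<Sum>e\<in>E. \<Sum>\<tau>\<in>{..<D e} \<rightarrow>\<^sub>E slots d. \<alpha> e * (\<Prod>s<D e. c (fst (\<tau> s)) * H e s (\<tau> s)))"
      by (simp add: prod_sum_PiE finite_slots sum_distrib_left)
    also have "\<dots> = (\<Sum>q\<in>R. \<alpha> (fst q) * (\<Prod>s<D (fst q). c (fst (snd q s)) * H (fst q) s (snd q s)))"
      unfolding R_def using E
      by (subst sum.Sigma) (auto simp: finite_slots case_prod_unfold intro!: finite_PiE)
    finally show ?thesis
      by (simp add: M_def prod.distrib prod_unfold_prod_mset image_mset.compositionality comp_def mult_ac)
  qed
  then have sum_R': "(\<Sum>q | q \<in> R \<and> M (fst q) (snd q) = mset_set {..<d}.
      \<alpha> (fst q) * (\<Prod>s<D (fst q). H (fst q) s (snd q s))) = 0" (is "sum ?h ?R' = 0")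
    by (rule monomial_coefficient_zero[OF fin_R])
  \<comment> \<open>Containing each \<open>c t\<close> with \<open>t < d\<close> exactly once forces
    degree \<open>d\<close> and makes the matching of factors with products bijective.\<close>
  have R': "e \<in> E \<and> D e = d \<and> \<tau> \<in> arrangements d" if "(e, \<tau>) \<in> ?R'" for e \<tau>
  proof -
    have e: "e \<in> E" "\<tau> \<in> {..<D e} \<rightarrow>\<^sub>E slots d" "M e \<tau> = mset_set {..<d}"
      using that by (simp_all add: R_def)
    have "D e = d"
      using arg_cong[OF e(3), of size] by (simp add: M_def)
    with e show ?thesis
      using bij_betw_of_image_mset_eq[of "{..<D e}" "{..<d}" "\<lambda>s. fst (\<tau> s)"]
      by (simp add: arrangements_def M_def)
  qed
  have "sum ?h ?Q = sum ?h ?R'"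
  proof (rule sum.mono_neutral_left)
    show "finite ?R'"
      using fin_R by simp
    show "?Q \<subseteq> ?R'"
    proof
      fix q assume "q \<in> ?Q"
      then obtain e \<tau> where q: "q = (e, \<tau>)" "e \<in> E" "D e = d" "\<tau> \<in> arrangements d"
        by auto
      then have "\<tau> \<in> {..<d} \<rightarrow>\<^sub>E slots d" "bij_betw (\<lambda>s. fst (\<tau> s)) {..<d} {..<d}"
        by (simp_all add: arrangements_def)
      with q show "q \<in> ?R'"
        by (simp add: R_def M_def bij_betw_def image_mset_mset_set)
    qed
    \<comment> \<open>A mismatch of first indices makes one factor \<open>H\<close> vanish.\<close>
    show "\<forall>q\<in>?R' - ?Q. ?h q = 0"
    proof
      fix q assume q: "q \<in> ?R' - ?Q"
      obtain e \<tau> where e: "q = (e, \<tau>)"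
        by fastforce
      then have "D e = d" "\<exists>s<d. \<iota> e s \<noteq> j (fst (\<tau> s))"
        using q R'[of e \<tau>] by blast+
      then obtain s where "s < D e" "\<iota> e s \<noteq> j (fst (\<tau> s))"
        by blast
      then have "(\<Prod>s<D e. H e s (\<tau> s)) = 0"
        by (intro prod_zero) (auto simp: H_def)
      then show "?h q = 0"
        by (simp add: e)
    qed
  qed
  moreover have "(\<Sum>(e, \<tau>)\<in>?Q. \<alpha> e * (\<Prod>p\<in>slots d. g (a (twist \<tau> p)) (w e p))) = sum ?h ?Q"
  proof (intro sum.cong refl)
    fix q assume "q \<in> ?Q"
    then obtain e \<tau> where e: "q = (e, \<tau>)" "D e = d" "\<forall>s<d. \<iota> e s = j (fst (\<tau> s))"
      by blast
    have "(\<Prod>p\<in>slots d. g (a (twist \<tau> p)) (w e p)) =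
        (\<Prod>s<d. \<Prod>b\<in>UNIV. g (a (twist \<tau> (s, b))) (w e (s, b)))"
      unfolding slots_def prod.cartesian_product by (intro prod.cong) auto
    also have "\<dots> = (\<Prod>s<D e. H e s (\<tau> s))"
      using e by (intro prod.cong) (auto simp: H_def twist_def UNIV_bool)
    finally show "(case q of (e, \<tau>) \<Rightarrow> \<alpha> e * (\<Prod>p\<in>slots d. g (a (twist \<tau> p)) (w e p))) = ?h q"
      by (simp add: e(1))
  qed
  ultimately show ?thesis
    using sum_R' by simp
qed

section \<open>The ideal of the subspace variety\<close>

lemma obtain_ordered_words:
  obtains ord and idx :: "'a::finite \<Rightarrow> nat" where "ordered_words (slots d) ord idx"
proof -
  obtain ord :: "nat \<times> bool \<Rightarrow> nat" where "inj_on ord (slots d)"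
    using finite_imp_inj_to_nat_seg[OF finite_slots] by blast
  moreover obtain idx :: "'a \<Rightarrow> nat" where "inj idx"
    using finite_imp_inj_to_nat_seg[of "UNIV :: 'a set"] by auto
  ultimately show thesis
    using that by (simp add: ordered_words_def finite_slots)
qed

lemma single_sum: "Poly_Mapping.single k (sum f A) = (\<Sum>a\<in>A. Poly_Mapping.single k (f a))"
  by (induction A rule: infinite_finite_induct) (simp_all add: single_add)

text \<open>Collecting the polarised terms by their rearranged words gives a multilinear form to
  which the second fundamental theorem applies. Translating back recovers the original monomials,
  which rearranging does not change.\<close>

lemma polarisation_in_I_kappa0_le:
  fixes \<iota> :: "'e \<Rightarrow> nat \<Rightarrow> 'm::finite" and w :: "'e \<Rightarrow> nat \<times> bool \<Rightarrow> 'n::finite"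
  assumes E: "finite E" and r: "r \<le> CARD('n)"
    and f: "\<And>x. x \<in> (subspace_variety CARD('m) r :: ('m, 'n) sym_tensor set) \<Longrightarrow>
        (\<Sum>e\<in>E. \<alpha> e * poly_eval x (slot_monomial (D e) (\<iota> e) (w e))) = 0"
  shows "(\<Sum>(e, \<tau>) | e \<in> E \<and> D e = d \<and> \<tau> \<in> arrangements d \<and> (\<forall>s<d. \<iota> e s = j (fst (\<tau> s))).
           Poly_Mapping.single 0 (\<alpha> e) * slot_monomial d (\<iota> e) (w e)) \<in> I_kappa0_le r"
    (is "sum _ ?Q \<in> _")
proof -
  obtain ord and idx :: "'n \<Rightarrow> nat" where ord: "ordered_words (slots d) ord idx"
    by (rule obtain_ordered_words)
  interpret ordered_words "slots d" ord idx
    by (rule ord)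
  define u where "u q = rearranged d (snd q) (w (fst q))" for q
  define c where "c v = (\<Sum>q | q \<in> ?Q \<and> u q = v. \<alpha> (fst q))" for v
  have fin: "finite ?Q"
    by (rule finite_subset[of _ "E \<times> arrangements d"]) (auto simp: E finite_arrangements)
  have u: "u ` ?Q \<subseteq> words"
    by (auto simp: u_def words_def rearranged_def)
  have "(\<Sum>v\<in>words. Poly_Mapping.single 0 (c v) * slot_monomial d j v) \<in> I_kappa0_le r"
  proof (rule multilinear_second_fundamental_theorem)
    show "(\<Sum>\<sigma> | \<sigma> permutes S. of_int (sign \<sigma>) * slot_monomial d j (v \<circ> \<sigma>)) \<in> I_kappa0_le r"
      if "S \<subseteq> slots d" "card S = Suc r" for v S
      using that by (intro antisymmetriser_in_I_kappa0_le) (simp_all add: slots_def)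
  next
    fix a :: "nat \<times> bool \<Rightarrow> nat" and g :: "nat \<Rightarrow> 'n \<Rightarrow> complex"
    assume a: "\<And>p. p \<in> slots d \<Longrightarrow> a p < r"
    have "(\<Sum>v\<in>words. c v * (\<Prod>p\<in>slots d. g (a p) (v p))) =
        (\<Sum>v\<in>words. \<Sum>q | q \<in> ?Q \<and> u q = v. \<alpha> (fst q) * (\<Prod>p\<in>slots d. g (a p) (u q p)))"
      unfolding c_def sum_distrib_right by (intro sum.cong refl) simp
    also have "\<dots> = (\<Sum>q\<in>?Q. \<alpha> (fst q) * (\<Prod>p\<in>slots d. g (a p) (u q p)))"
      by (rule sum.group[OF fin finite_words u])
    also have "\<dots> = (\<Sum>(e, \<tau>)\<in>?Q. \<alpha> e * (\<Prod>p\<in>slots d. g (a (twist \<tau> p)) (w e p)))"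
    proof (intro sum.cong refl)
      fix q assume "q \<in> ?Q"
      then obtain e \<tau> where q: "q = (e, \<tau>)" "\<tau> \<in> arrangements d"
        by blast
      have "(\<Prod>p\<in>slots d. g (a p) (u q p)) = (\<Prod>p\<in>slots d. g (a (twist \<tau> p)) (u q (twist \<tau> p)))"
        by (rule prod.reindex_bij_betw[OF bij_betw_twist[OF q(2)], symmetric])
      also have "\<dots> = (\<Prod>p\<in>slots d. g (a (twist \<tau> p)) (w e p))"
        by (intro prod.cong refl) (simp add: u_def q rearranged_twist)
      finally show "\<alpha> (fst q) * (\<Prod>p\<in>slots d. g (a p) (u q p)) =
          (case q of (e, \<tau>) \<Rightarrow> \<alpha> e * (\<Prod>p\<in>slots d. g (a (twist \<tau> p)) (w e p)))"
        by (simp add: q)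
    qed
    also have "\<dots> = 0"
      by (rule polarisation_vanishes[OF E r f a])
    finally show "(\<Sum>v\<in>words. c v * (\<Prod>p\<in>slots d. g (a p) (v p))) = 0" .
  qed (auto simp: I_kappa0_le_def ideal_generated_0 ideal_generated_add ideal_generated_mult
      single_diff mult_single)
  also have "(\<Sum>v\<in>words. Poly_Mapping.single 0 (c v) * slot_monomial d j v) =
      (\<Sum>v\<in>words. \<Sum>q | q \<in> ?Q \<and> u q = v. Poly_Mapping.single 0 (\<alpha> (fst q)) * slot_monomial d j (u q))"
    unfolding c_def by (intro sum.cong refl) (simp add: single_sum sum_distrib_right)
  also have "\<dots> = (\<Sum>q\<in>?Q. Poly_Mapping.single 0 (\<alpha> (fst q)) * slot_monomial d j (u q))"
    by (rule sum.group[OF fin finite_words u])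
  also have "\<dots> = (\<Sum>(e, \<tau>)\<in>?Q. Poly_Mapping.single 0 (\<alpha> e) * slot_monomial d (\<iota> e) (w e))"
  proof (intro sum.cong refl)
    fix q assume "q \<in> ?Q"
    then obtain e \<tau> where q: "q = (e, \<tau>)" "\<tau> \<in> arrangements d" "\<And>s. s < d \<Longrightarrow> \<iota> e s = j (fst (\<tau> s))"
      by blast
    have "slot_monomial d j (u q) = slot_monomial d (\<iota> e) (w e)"
      using slot_monomial_rearranged[of \<tau> d "\<iota> e" j "w e"] q by (simp add: u_def)
    then show "Poly_Mapping.single 0 (\<alpha> (fst q)) * slot_monomial d j (u q) =
        (case q of (e, \<tau>) \<Rightarrow> Poly_Mapping.single 0 (\<alpha> e) * slot_monomial d (\<iota> e) (w e))"
      by (simp add: q(1))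
  qed
  finally show ?thesis .
qed

lemma I_kappa0_le_sum: "(\<And>a. a \<in> A \<Longrightarrow> p a \<in> I_kappa0_le r) \<Longrightarrow> sum p A \<in> I_kappa0_le r"
  by (induction A rule: infinite_finite_induct)
    (auto simp: I_kappa0_le_def ideal_generated_0 ideal_generated_add)

text \<open>In degree \<open>d\<close>, summing the polarisations over all sequences
  \<open>j\<close> of first indices counts each monomial once per arrangement. The number of
  arrangements is invertible in the complex numbers, so every homogeneous component lies in the
  ideal.\<close>

lemma sum_monomials_in_I_kappa0_le:
  fixes \<iota> :: "'e \<Rightarrow> nat \<Rightarrow> 'm::finite" and w :: "'e \<Rightarrow> nat \<times> bool \<Rightarrow> 'n::finite"
  assumes E: "finite E" and r: "r \<le> CARD('n)"
    and f: "\<And>x. x \<in> (subspace_variety CARD('m) r :: ('m, 'n) sym_tensor set) \<Longrightarrow>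
        (\<Sum>e\<in>E. \<alpha> e * poly_eval x (slot_monomial (D e) (\<iota> e) (w e))) = 0"
  shows "(\<Sum>e\<in>E. Poly_Mapping.single 0 (\<alpha> e) * slot_monomial (D e) (\<iota> e) (w e)) \<in> I_kappa0_le r"
proof -
  let ?h = "\<lambda>e. Poly_Mapping.single 0 (\<alpha> e) * slot_monomial (D e) (\<iota> e) (w e)"
  have component: "(\<Sum>e | e \<in> E \<and> D e = d. ?h e) \<in> I_kappa0_le r" for d
  proof -
    let ?Z = "{e \<in> E. D e = d} \<times> arrangements d"
    \<comment> \<open>The only sequence \<open>j\<close> to which the pair \<open>q\<close>
      contributes, found by inverting the permutation of the factors.\<close>
    define J where "J q = (\<lambda>t\<in>{..<d}. \<iota> (fst q) (inv_into {..<d} (\<lambda>s. fst (snd q s)) t))"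
      for q :: "'e \<times> (nat \<Rightarrow> nat \<times> bool)"
    have J: "J (e, \<tau>) = j \<longleftrightarrow> (\<forall>s<d. \<iota> e s = j (fst (\<tau> s)))"
      if "\<tau> \<in> arrangements d" "j \<in> {..<d} \<rightarrow>\<^sub>E UNIV" for e \<tau> j
    proof -
      let ?\<pi> = "\<lambda>s. fst (\<tau> s)"
      have \<pi>: "inj_on ?\<pi> {..<d}" "?\<pi> ` {..<d} = {..<d}"
        using that(1) unfolding arrangements_def bij_betw_def by blast+
      have "J (e, \<tau>) = j \<longleftrightarrow> (\<forall>t\<in>{..<d}. J (e, \<tau>) t = j t)"
      proof
        assume eq: "\<forall>t\<in>{..<d}. J (e, \<tau>) t = j t"
        have "J (e, \<tau>) \<in> {..<d} \<rightarrow>\<^sub>E UNIV"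
          by (simp add: J_def)
        then show "J (e, \<tau>) = j"
          using PiE_ext[OF _ that(2)] eq by blast
      qed simp
      also have "\<dots> \<longleftrightarrow> (\<forall>t\<in>?\<pi> ` {..<d}. J (e, \<tau>) t = j t)"
        by (simp only: \<pi>(2))
      also have "\<dots> \<longleftrightarrow> (\<forall>s<d. J (e, \<tau>) (?\<pi> s) = j (?\<pi> s))"
        by auto
      also have "\<dots> \<longleftrightarrow> (\<forall>s<d. \<iota> e s = j (?\<pi> s))"
      proof (intro all_cong)
        fix s assume "s < d"
        then have "?\<pi> s \<in> ?\<pi> ` {..<d}"
          by simp
        then have "?\<pi> s < d"
          by (simp only: \<pi>(2) lessThan_iff)
        then show "J (e, \<tau>) (?\<pi> s) = j (?\<pi> s) \<longleftrightarrow> \<iota> e s = j (?\<pi> s)"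
          using inv_into_f_f[OF \<pi>(1)] \<open>s < d\<close> by (simp add: J_def)
      qed
      finally show ?thesis .
    qed
    have fin: "finite ?Z" "finite ({..<d} \<rightarrow>\<^sub>E (UNIV :: 'm set))"
      using E by (simp_all add: finite_arrangements finite_PiE)
    have "(\<Sum>q\<in>?Z. ?h (fst q)) =
        (\<Sum>j\<in>{..<d} \<rightarrow>\<^sub>E UNIV. \<Sum>q | q \<in> ?Z \<and> J q = j. ?h (fst q))"
      by (rule sum.group[OF fin, symmetric]) (auto simp: J_def split: if_splits)
    also have "\<dots> \<in> I_kappa0_le r"
    proof (rule I_kappa0_le_sum)
      fix j :: "nat \<Rightarrow> 'm" assume j: "j \<in> {..<d} \<rightarrow>\<^sub>E UNIV"
      have "(\<Sum>q | q \<in> ?Z \<and> J q = j. ?h (fst q)) =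
          (\<Sum>(e, \<tau>) | e \<in> E \<and> D e = d \<and> \<tau> \<in> arrangements d \<and> (\<forall>s<d. \<iota> e s = j (fst (\<tau> s))).
            Poly_Mapping.single 0 (\<alpha> e) * slot_monomial d (\<iota> e) (w e))"
      proof (rule sum.cong)
        show "{q. q \<in> ?Z \<and> J q = j} =
            {(e, \<tau>). e \<in> E \<and> D e = d \<and> \<tau> \<in> arrangements d \<and> (\<forall>s<d. \<iota> e s = j (fst (\<tau> s)))}"
          using J[OF _ j] by auto
      qed auto
      then show "(\<Sum>q | q \<in> ?Z \<and> J q = j. ?h (fst q)) \<in> I_kappa0_le r"
        using polarisation_in_I_kappa0_le[OF E r f] by simp
    qed
    also have "(\<Sum>q\<in>?Z. ?h (fst q)) = of_nat (card (arrangements d)) * (\<Sum>e | e \<in> E \<and> D e = d. ?h e)"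
    proof -
      have "(\<Sum>q\<in>?Z. ?h (fst q)) = (\<Sum>e | e \<in> E \<and> D e = d. \<Sum>\<tau>\<in>arrangements d. ?h e)"
        unfolding sum.cartesian_product by (intro sum.cong) auto
      then show ?thesis
        by (simp only: sum_constant sum_distrib_left)
    qed
    finally have "Poly_Mapping.single 0 (1 / of_nat (card (arrangements d)) :: complex) *
        (of_nat (card (arrangements d)) * (\<Sum>e | e \<in> E \<and> D e = d. ?h e)) \<in> I_kappa0_le r"
      by (simp only: I_kappa0_le_def ideal_generated_mult)
    moreover have "Poly_Mapping.single 0 (1 / of_nat (card (arrangements d)) :: complex) *
        of_nat (card (arrangements d)) = (1 :: ('m \<times> 'n uprod) mpolynomial)"
    proof -
      have "card (arrangements d) \<noteq> 0"
        using arrangements_nonempty finite_arrangements by simp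
      then have "Poly_Mapping.single 0 (1 / of_nat (card (arrangements d)) :: complex) *
          Poly_Mapping.single 0 (of_nat (card (arrangements d))) = (1 :: ('m \<times> 'n uprod) mpolynomial)"
        by (simp add: mult_single del: single_of_nat)
      then show ?thesis by simp
    qed
    ultimately show ?thesis
      by (simp add: mult.assoc[symmetric])
  qed
  have "(\<Sum>e\<in>E. ?h e) = (\<Sum>d\<in>D ` E. \<Sum>e | e \<in> E \<and> D e = d. ?h e)"
    by (rule sum.image_gen[OF E])
  then show ?thesis
    using component by (simp add: I_kappa0_le_sum)
qed

text \<open>An arbitrary ordering of each unordered pair assigns its entries to the two slots of the
  factor.\<close>

lemma monomial_eq_slot_monomial:
  obtains d and \<iota> :: "nat \<Rightarrow> 'm::finite" and w :: "nat \<times> bool \<Rightarrow> 'n::finite"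
  where "Poly_Mapping.single e 1 = slot_monomial d \<iota> w"
proof -
  obtain d :: nat and v :: "nat \<Rightarrow> 'm \<times> 'n uprod" where
    e: "Poly_Mapping.single e 1 = (\<Prod>s<d. Var (v s))"
    by (rule monomial_eq_prod_Var)
  have "\<exists>j k. v s = (fst (v s), Upair j k)" for s
    by (cases "v s"; cases "snd (v s)" rule: uprod_exhaust) auto
  then obtain j k where "\<And>s. v s = (fst (v s), Upair (j s) (k s))"
    by metis
  then have "Poly_Mapping.single e 1 =
      slot_monomial d (\<lambda>s. fst (v s)) (\<lambda>(s, b). if b then k s else j s)"
    unfolding e slot_monomial_def by (intro prod.cong refl) simp
  then show thesis
    by (rule that)
qed

theorem proposition4p3:
  fixes n' :: nat
  assumes "1 \<le> n'" and "n' \<le> CARD('n::finite)"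
  shows "vanishing_ideal (subspace_variety CARD('m::finite) n' :: ('m, 'n) sym_tensor set) =
         I_kappa0_le n'"
proof (rule antisym[OF _ I_kappa0_le_subset_vanishing_ideal], rule subsetI)
  fix f assume f: "f \<in> vanishing_ideal (subspace_variety CARD('m) n' :: ('m, 'n) sym_tensor set)"
  \<comment> \<open>One presentation by slots is chosen for every exponent vector; those occurring
    in \<open>f\<close> then index the sum of monomials.\<close>
  obtain D and \<iota> :: "_ \<Rightarrow> nat \<Rightarrow> 'm" and w :: "_ \<Rightarrow> nat \<times> bool \<Rightarrow> 'n" where
    monomial: "\<And>e. Poly_Mapping.single e 1 = slot_monomial (D e) (\<iota> e) (w e)"
    using monomial_eq_slot_monomial by metis
  have single: "Poly_Mapping.single e a = Poly_Mapping.single 0 a * slot_monomial (D e) (\<iota> e) (w e)"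
    for e a
    by (simp add: monomial[symmetric] mult_single)
  let ?p = "\<Sum>e\<in>Poly_Mapping.keys f.
      Poly_Mapping.single 0 (Poly_Mapping.lookup f e) * slot_monomial (D e) (\<iota> e) (w e)"
  have f_eq: "f = ?p"
    by (rule trans[OF poly_eq_sum_monomials]) (intro sum.cong refl single)
  have "?p \<in> I_kappa0_le n'"
  proof (rule sum_monomials_in_I_kappa0_le)
    fix x :: "('m, 'n) sym_tensor" assume "x \<in> subspace_variety CARD('m) n'"
    then have "poly_eval x ?p = 0"
      using f by (simp add: vanishing_ideal_def flip: f_eq)
    then show "(\<Sum>e\<in>Poly_Mapping.keys f.
        Poly_Mapping.lookup f e * poly_eval x (slot_monomial (D e) (\<iota> e) (w e))) = 0"
      by (simp add: poly_eval_sum poly_eval_mult poly_eval_single)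
  qed (simp_all add: assms)
  with f_eq show "f \<in> I_kappa0_le n'"
    by simp
qed

end
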